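(* Let $\varphi$ be a Banach bundle map from the Banach bundle $\xi_1=(\mathcal{E}_1,p_1,T)$ to the continuous Banach bundle $\xi_2=(\mathcal{E}_2,p_2,T)$ with $\varphi(\mathcal{E}_1)=\mathcal{E}_2$. Suppose that $\mathcal{E}_2$ is paracompact and that there exists $m>0$ with the property that for every $y\in\mathcal{E}_2$ there exists $x\in\mathcal{E}_1$ such that $\varphi(x)=y$ and $\|x\|\leq m\|y\|$. Then there exists a continuous map $\psi:\mathcal{E}_2\to\mathcal{E}_1$ such that $\varphi(\psi(y))=y$ and $\psi(\lambda y)=\lambda\psi(y)$ for every $y\in\mathcal{E}_2$ and $\lambda\in\mathbb{K}$.
   Context: $\mathbb{K}$ is the real or the complex field (the scalar field of all Banach spaces considered). A Banach bundle $\xi=(\mathcal{E},p,T)$ consists of a Hausdorff space $T$ (base space), a topological space $\mathcal{E}$ (bundle space, not assumed Hausdorff), and a continuous open surjection $p:\mathcal{E}\to T$ such that each fiber $\mathcal{E}(t)=p^{-1}(t)$ is a Banach space over $\mathbb{K}$ with origin $0_t$, and: addition $\{(x,y)\in\mathcal{E}\times\mathcal{E}: p(x)=p(y)\}\to\mathcal{E}$ and scalar multiplication $\mathbb{K}\times\mathcal{E}\to\mathcal{E}$ are continuous; $x\mapsto\|x\|$ is upper semi-continuous on $\mathcal{E}$; and if $(x_\iota)$ is a net in $\mathcal{E}$ with $p(x_\iota)\to t$ and $\|x_\iota\|\to 0$, then $x_\iota\to 0_t$. The bundle is continuous if $x\mapsto\|x\|$ is continuous on $\mathcal{E}$. Paracompact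 spaces are assumed Hausdorff. A Banach bundle map from $\xi_1$ to $\xi_2$ is a continuous map $\varphi:\mathcal{E}_1\to\mathcal{E}_2$ with $\varphi(p_1^{-1}(t))\subset p_2^{-1}(t)$ for every $t\in T$ whose restriction to each fiber is linear. *)

theory Defs
  imports "HOL-Analysis.Analysis"
begin

text \<open>
  The library states paracompactness only for Euclidean spaces. Hausdorff is part of the
  definition.
\<close>

definition paracompact_space :: "'a topology \<Rightarrow> bool" where
  "paracompact_space X \<longleftrightarrow>
     Hausdorff_space X \<and>
     (\<forall>\<U>. (\<forall>U\<in>\<U>. openin X U) \<and> \<Union>\<U> = topspace X \<longrightarrow>
        (\<exists>\<V>. (\<forall>V\<in>\<V>. openin X V) \<and> \<Union>\<V> = topspace X \<and>
             (\<forall>V\<in>\<V>. \<exists>U\<in>\<U>. V \<subseteq> U) \<and> locally_finite_in X \<V>))"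

text \<open>
  To treat real and complex scalars uniformly, the scalar field is a subset \<open>K\<close> of the complex
  numbers, either \<open>\<real>\<close> or \<open>UNIV\<close>; scalar multiplication by numbers outside \<open>K\<close> is irrelevant.
  The fibers of a bundle are subsets of one type, so they cannot be instances of the type class
  \<open>banach\<close> and the axioms are relativised to the carrier \<open>V\<close>.
\<close>

locale banach_space_on =
  fixes K :: "complex set"
    and V :: "'e set"
    and add :: "'e \<Rightarrow> 'e \<Rightarrow> 'e"
    and scale :: "complex \<Rightarrow> 'e \<Rightarrow> 'e"
    and zero :: 'e
    and nrm :: "'e \<Rightarrow> real"
  assumes zero_closed: "zero \<in> V"
    and add_closed: "\<lbrakk>x \<in> V; y \<in> V\<rbrakk> \<Longrightarrow> add x y \<in> V"
    and scale_closed: "\<lbrakk>c \<in> K; x \<in> V\<rbrakk> \<Longrightarrow> scale c x \<in> V"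
    and add_assoc: "\<lbrakk>x \<in> V; y \<in> V; z \<in> V\<rbrakk> \<Longrightarrow> add (add x y) z = add x (add y z)"
    and add_commute: "\<lbrakk>x \<in> V; y \<in> V\<rbrakk> \<Longrightarrow> add x y = add y x"
    and add_zero: "x \<in> V \<Longrightarrow> add x zero = x"
    and add_inverse: "x \<in> V \<Longrightarrow> \<exists>y\<in>V. add x y = zero"
    and scale_add: "\<lbrakk>c \<in> K; x \<in> V; y \<in> V\<rbrakk> \<Longrightarrow> scale c (add x y) = add (scale c x) (scale c y)"
    and add_scale: "\<lbrakk>c \<in> K; d \<in> K; x \<in> V\<rbrakk> \<Longrightarrow> scale (c + d) x = add (scale c x) (scale d x)"
    and scale_scale: "\<lbrakk>c \<in> K; d \<in> K; x \<in> V\<rbrakk> \<Longrightarrow> scale c (scale d x) = scale (c * d) x"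
    and scale_one: "x \<in> V \<Longrightarrow> scale 1 x = x"
    and nrm_nonneg: "x \<in> V \<Longrightarrow> 0 \<le> nrm x"
    and nrm_eq_zero: "x \<in> V \<Longrightarrow> nrm x = 0 \<longleftrightarrow> x = zero"
    and nrm_triangle: "\<lbrakk>x \<in> V; y \<in> V\<rbrakk> \<Longrightarrow> nrm (add x y) \<le> nrm x + nrm y"
    and nrm_scale: "\<lbrakk>c \<in> K; x \<in> V\<rbrakk> \<Longrightarrow> nrm (scale c x) = cmod c * nrm x"
    and cauchy_converges:
      "\<lbrakk>\<And>n::nat. \<sigma> n \<in> V;
        \<And>e. 0 < e \<Longrightarrow> \<exists>N. \<forall>m\<ge>N. \<forall>n\<ge>N. nrm (add (\<sigma> m) (scale (-1) (\<sigma> n))) < e\<rbrakk>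
       \<Longrightarrow> \<exists>l\<in>V. (\<lambda>n. nrm (add (\<sigma> n) (scale (-1) l))) \<longlonglongrightarrow> 0"

record ('e, 'b) bundle_data =
  bspace :: "'e topology"
  base :: "'b topology"
  proj :: "'e \<Rightarrow> 'b"
  fadd :: "'e \<Rightarrow> 'e \<Rightarrow> 'e"
  fscale :: "complex \<Rightarrow> 'e \<Rightarrow> 'e"
  fzero :: "'b \<Rightarrow> 'e"
  fnorm :: "'e \<Rightarrow> real"

definition fiber :: "('e, 'b) bundle_data \<Rightarrow> 'b \<Rightarrow> 'e set" where
  "fiber \<xi> t = {x \<in> topspace (bspace \<xi>). proj \<xi> x = t}"

text \<open>
  In the axiom \<open>tendsto_zero\<close>, nets in the bundle space are given by filters on it (for a net, the
  filter of properties that hold eventually along it); every filter arises in this way.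
  The version for arbitrary index types is the lemma \<open>limitin_fzero\<close> below.
\<close>

locale banach_bundle =
  fixes K :: "complex set" and \<xi> :: "('e, 'b) bundle_data"
  assumes base_Hausdorff: "Hausdorff_space (base \<xi>)"
    and proj_continuous: "continuous_map (bspace \<xi>) (base \<xi>) (proj \<xi>)"
    and proj_open: "open_map (bspace \<xi>) (base \<xi>) (proj \<xi>)"
    and proj_surj: "proj \<xi> ` topspace (bspace \<xi>) = topspace (base \<xi>)"
    and fiber_banach: "t \<in> topspace (base \<xi>) \<Longrightarrow>
      banach_space_on K (fiber \<xi> t) (fadd \<xi>) (fscale \<xi>) (fzero \<xi> t) (fnorm \<xi>)"
    and add_continuous: "continuous_map
      (subtopology (prod_topology (bspace \<xi>) (bspace \<xi>)) {(x, y). proj \<xi> x = proj \<xi> y})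
      (bspace \<xi>) (\<lambda>(x, y). fadd \<xi> x y)"
    and scale_continuous: "continuous_map
      (prod_topology (top_of_set K) (bspace \<xi>)) (bspace \<xi>) (\<lambda>(c, x). fscale \<xi> c x)"
    and norm_usc: "openin (bspace \<xi>) {x \<in> topspace (bspace \<xi>). fnorm \<xi> x < r}"
    and tendsto_zero: "\<lbrakk>eventually (\<lambda>x. x \<in> topspace (bspace \<xi>)) F;
        limitin (base \<xi>) (proj \<xi>) t F; (fnorm \<xi> \<longlongrightarrow> 0) F\<rbrakk>
      \<Longrightarrow> limitin (bspace \<xi>) (\<lambda>x. x) (fzero \<xi> t) F"

lemma (in banach_bundle) limitin_fzero:
  assumes "eventually (\<lambda>i. x i \<in> topspace (bspace \<xi>)) F"
    and "limitin (base \<xi>) (\<lambda>i. proj \<xi> (x i)) t F"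
    and "((\<lambda>i. fnorm \<xi> (x i)) \<longlongrightarrow> 0) F"
  shows "limitin (bspace \<xi>) x (fzero \<xi> t) F"
  using tendsto_zero[of "filtermap x F" t] assms
  by (simp add: limitin_def eventually_filtermap filterlim_filtermap)

locale continuous_banach_bundle = banach_bundle +
  assumes norm_continuous: "continuous_map (bspace \<xi>) euclideanreal (fnorm \<xi>)"

text \<open>The two bundles are meant to have the same base space.\<close>

definition banach_bundle_map ::
  "complex set \<Rightarrow> ('e, 'b) bundle_data \<Rightarrow> ('f, 'b) bundle_data \<Rightarrow> ('e \<Rightarrow> 'f) \<Rightarrow> bool" where
  "banach_bundle_map K \<xi>1 \<xi>2 \<phi> \<longleftrightarrow>
     continuous_map (bspace \<xi>1) (bspace \<xi>2) \<phi> \<and>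
     (\<forall>t\<in>topspace (base \<xi>1).
        \<phi> ` fiber \<xi>1 t \<subseteq> fiber \<xi>2 t \<and>
        (\<forall>x\<in>fiber \<xi>1 t. \<forall>y\<in>fiber \<xi>1 t. \<phi> (fadd \<xi>1 x y) = fadd \<xi>2 (\<phi> x) (\<phi> y)) \<and>
        (\<forall>c\<in>K. \<forall>x\<in>fiber \<xi>1 t. \<phi> (fscale \<xi>1 c x) = fscale \<xi>2 c (\<phi> x)))"

end

(*
  Since phi is fiberwise linear and lifts with norm bound m, it is open.  No continuous local
  sections are available a priori, so Michael's selection argument is run with exact but
  discontinuous lifts f_n of phi that are "2^-n-continuous": near each point f_n(y) is within 2^-n
  of every prescribed neighbourhood of its value.  Such lifts are patched, with a partition of unity
  on the paracompact space E_2, from arbitrary choices inside open sets of small fiberwise diameter;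
  successive f_n are uniformly close, and their limit f is a continuous lift with
  |f(y)| <= m |y| + const.

  To make f equivariant under scalars of modulus 1 one averages c^-1 f(c y) successively over the
  2^k-th roots of unity (over {1, -1} in the real case); by compactness of the circle the averages
  converge locally uniformly to an equivariant lift h.  Finally psi(y) = |y| h(y / |y|).
*)
theory Submission
  imports Defs "HOL-Algebra.FiniteProduct"
begin

section \<open>Partitions of unity on paracompact spaces\<close>


text \<open>The norm of \<open>\<xi>1\<close> is only upper semicontinuous and its bundle space need
  not be Hausdorff, so in E_1 only conditions such as norm < r are open, and limits are identified
  through fiber norms or in E_2. Two facts stand in for local sections: every point has open
  neighbourhoods of arbitrarily small fiberwise diameter, and, the projection being open, an open
  set meets all fibers near one that it meets. Convex combinations respect the lifting equation
  because the preimages \<open>\<phi>\<close>^-1(y) are affine. The additive constant in the norm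
  bound absorbs the variation of the norms near a point. It does no harm in the end: away from zero
  vectors only the values of h at unit vectors enter psi, so |psi(y)| is at most a constant times
  |y|. Finite averages take the place of a Haar integral, so no integration in varying fibers
  occurs. One half-sum leads from one set of roots to the next, because the square of the new root
  is a power of the old one; convexity of balls then keeps all later averages near one that is
  already almost invariant.\<close>

lemma continuous_map_if_locally:
  assumes "\<And>x. x \<in> topspace X \<Longrightarrow> \<exists>N. openin X N \<and> x \<in> N \<and> continuous_map (subtopology X N) Y f"
  shows "continuous_map X Y f"
proof -
  obtain N where N: "\<And>x. x \<in> topspace X \<Longrightarrow> openin X (N x) \<and> x \<in> N x \<and> continuous_map (subtopology X (N x)) Y f"
    using assms by metis
  show ?thesis
    by (rule pasting_lemma[where I = "topspace X" and T = N and f = "\<lambda>_. f"]) (use N in auto)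
qed

lemma paracompact_refinement:
  assumes "paracompact_space X" "\<And>U. U \<in> \<U> \<Longrightarrow> openin X U" "\<Union>\<U> = topspace X"
  obtains \<V> where "\<And>V. V \<in> \<V> \<Longrightarrow> openin X V" "\<Union>\<V> = topspace X"
    "\<And>V. V \<in> \<V> \<Longrightarrow> \<exists>U\<in>\<U>. V \<subseteq> U" "locally_finite_in X \<V>"
proof -
  have "\<exists>\<V>. (\<forall>V\<in>\<V>. openin X V) \<and> \<Union>\<V> = topspace X \<and> (\<forall>V\<in>\<V>. \<exists>U\<in>\<U>. V \<subseteq> U) \<and> locally_finite_in X \<V>"
    using assms(1)[unfolded paracompact_space_def, THEN conjunct2, THEN spec, of \<U>] assms(2,3) by simp
  then show ?thesis using that by metis
qed

text \<open>Refine the cover formed by the complement of A and the open sets whose closures miss B.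
  Members that meet A refine one of the latter, and closure commutes with locally finite unions. A
  single point as B yields regularity, which in turn supplies the hypothesis for closed B and so
  yields normality.\<close>

lemma paracompact_separation:
  assumes X: "paracompact_space X"
    and A: "closedin X A"
    and sep: "\<And>a. a \<in> A \<Longrightarrow> \<exists>U. openin X U \<and> a \<in> U \<and> disjnt B (X closure_of U)"
  shows "\<exists>V. openin X V \<and> A \<subseteq> V \<and> disjnt B (X closure_of V)"
proof -
  define \<U> where "\<U> = insert (topspace X - A) {U. openin X U \<and> disjnt B (X closure_of U)}"
  have opU: "openin X U" if "U \<in> \<U>" for U
    using A that by (auto simp: \<U>_def)
  have "topspace X \<subseteq> \<Union>\<U>"
    using sep by (auto simp: \<U>_def)
  with opU openin_subset have "\<Union>\<U> = topspace X"
    by blast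
  with opU obtain \<V> where op: "\<And>V. V \<in> \<V> \<Longrightarrow> openin X V" and cov: "\<Union>\<V> = topspace X"
    and ref: "\<And>V. V \<in> \<V> \<Longrightarrow> \<exists>U\<in>\<U>. V \<subseteq> U" and lf: "locally_finite_in X \<V>"
    using paracompact_refinement[OF X, of \<U>] by metis
  define \<W> where "\<W> = {V \<in> \<V>. V \<inter> A \<noteq> {}}"
  have lfW: "locally_finite_in X \<W>"
    by (rule locally_finite_in_subset[OF lf]) (auto simp: \<W>_def)
  have "disjnt B (X closure_of W)" if W: "W \<in> \<W>" for W
  proof -
    obtain U where "U \<in> \<U>" "W \<subseteq> U"
      using W ref by (auto simp: \<W>_def)
    moreover from this W have "disjnt B (X closure_of U)"
      by (auto simp: \<U>_def \<W>_def)
    ultimately show ?thesis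
      by (meson closure_of_mono disjnt_subset2)
  qed
  then have "disjnt B (X closure_of \<Union>\<W>)"
    by (auto simp: closure_of_locally_finite_Union[OF lfW] disjnt_def)
  moreover have "openin X (\<Union>\<W>)"
    using op by (auto simp: \<W>_def)
  moreover have "A \<subseteq> \<Union>\<W>"
  proof
    fix a assume a: "a \<in> A"
    then obtain V where "V \<in> \<V>" "a \<in> V"
      using closedin_subset[OF A] cov by blast
    with a show "a \<in> \<Union>\<W>" by (auto simp: \<W>_def)
  qed
  ultimately show ?thesis by blast
qed

lemma paracompact_imp_regular_space:
  assumes X: "paracompact_space X"
  shows "regular_space X"
  unfolding regular_space_def
proof (intro allI impI)
  fix C a assume C: "closedin X C \<and> a \<in> topspace X - C"
  have "\<exists>U. openin X U \<and> c \<in> U \<and> disjnt {a} (X closure_of U)" if "c \<in> C" for c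
  proof -
    have "c \<in> topspace X" "c \<noteq> a" "a \<in> topspace X"
      using C that closedin_subset by blast+
    moreover have "Hausdorff_space X"
      using X by (simp add: paracompact_space_def)
    ultimately obtain U V where UV: "openin X U" "openin X V" "c \<in> U" "a \<in> V" "disjnt U V"
      unfolding Hausdorff_space_def by blast
    then have "a \<notin> X closure_of U"
      by (auto simp: in_closure_of disjnt_iff)
    with UV show ?thesis by auto
  qed
  from paracompact_separation[OF X _ this, of C] C
  obtain V where "openin X V" "C \<subseteq> V" "a \<notin> X closure_of V"
    by (auto simp: disjnt_def)
  then show "\<exists>U V. openin X U \<and> openin X V \<and> a \<in> U \<and> C \<subseteq> V \<and> disjnt U V"
    using C closure_of_subset[OF openin_subset, of X V]
    by (intro exI[of _ "topspace X - X closure_of V"] exI[of _ V]) (auto simp: disjnt_def)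
qed

lemma paracompact_imp_normal_space:
  assumes X: "paracompact_space X"
  shows "normal_space X"
  unfolding normal_space
proof (intro allI impI)
  fix S T assume ST: "closedin X S \<and> closedin X T \<and> disjnt S T"
  have "\<exists>U. openin X U \<and> c \<in> U \<and> disjnt T (X closure_of U)" if "c \<in> S" for c
  proof -
    have "c \<in> topspace X - T"
      using ST that closedin_subset by (force simp: disjnt_iff)
    then show ?thesis
      using paracompact_imp_regular_space[OF X] ST unfolding regular_space by blast
  qed
  from paracompact_separation[OF X _ this, of S] ST
  show "\<exists>U. openin X U \<and> S \<subseteq> U \<and> disjnt T (X closure_of U)" by auto
qed

text \<open>Indexing the second refinement by the members of the first avoids the shrinking lemma:
  the closed sets \<open>F V\<close> below are locally finite unions of closures.\<close>

lemma paracompact_closed_shrinking: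
  assumes X: "paracompact_space X"
    and op: "\<And>U. U \<in> \<U> \<Longrightarrow> openin X U" and cov: "\<Union>\<U> = topspace X"
  obtains \<V> F where "\<And>V. V \<in> \<V> \<Longrightarrow> openin X V" "\<And>V. V \<in> \<V> \<Longrightarrow> \<exists>U\<in>\<U>. V \<subseteq> U"
    "locally_finite_in X \<V>" "\<And>V. V \<in> \<V> \<Longrightarrow> closedin X (F V)" "\<And>V. V \<in> \<V> \<Longrightarrow> F V \<subseteq> V"
    "\<Union>(F ` \<V>) = topspace X"
proof -
  obtain \<V> where opV: "\<And>V. V \<in> \<V> \<Longrightarrow> openin X V" and covV: "\<Union>\<V> = topspace X"
    and refV: "\<And>V. V \<in> \<V> \<Longrightarrow> \<exists>U\<in>\<U>. V \<subseteq> U" and lfV: "locally_finite_in X \<V>"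
    using paracompact_refinement[OF X op cov] by blast
  define \<C> where "\<C> = {C. openin X C \<and> (\<exists>V\<in>\<V>. X closure_of C \<subseteq> V)}"
  have "\<exists>C\<in>\<C>. x \<in> C" if x: "x \<in> topspace X" for x
  proof -
    obtain V where V: "V \<in> \<V>" "x \<in> V" using x covV by auto
    then have "closedin X (topspace X - V)" "x \<in> topspace X - (topspace X - V)"
      using opV x by auto
    then obtain C where "openin X C" "x \<in> C" "disjnt (topspace X - V) (X closure_of C)"
      using paracompact_imp_regular_space[OF X] unfolding regular_space by blast
    moreover from this have "X closure_of C \<subseteq> V"
      using closure_of_subset_topspace[of X C] by (auto simp: disjnt_def)
    ultimately show ?thesis using V by (auto simp: \<C>_def)
  qed
  then have "topspace X \<subseteq> \<Union>\<C>" by blast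
  moreover have opC: "openin X C" if "C \<in> \<C>" for C using that by (auto simp: \<C>_def)
  moreover have "\<Union>\<C> \<subseteq> topspace X" using opC openin_subset by blast
  ultimately have covC: "\<Union>\<C> = topspace X" by blast
  obtain \<W> where opW: "\<And>W. W \<in> \<W> \<Longrightarrow> openin X W" and covW: "\<Union>\<W> = topspace X"
    and refW: "\<And>W. W \<in> \<W> \<Longrightarrow> \<exists>C\<in>\<C>. W \<subseteq> C" and lfW: "locally_finite_in X \<W>"
    using paracompact_refinement[OF X opC covC] by blast
  have "\<exists>V\<in>\<V>. X closure_of W \<subseteq> V" if W: "W \<in> \<W>" for W
  proof -
    obtain C V where "C \<in> \<C>" "W \<subseteq> C" "V \<in> \<V>" "X closure_of C \<subseteq> V"
      using refW[OF W] by (auto simp: \<C>_def)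
    then show ?thesis
      using closure_of_mono[of W C X] by blast
  qed
  then obtain c where c: "\<And>W. W \<in> \<W> \<Longrightarrow> c W \<in> \<V> \<and> X closure_of W \<subseteq> c W" by metis
  define F where "F V = \<Union>((\<lambda>W. X closure_of W) ` {W \<in> \<W>. c W = V})" for V
  show ?thesis
  proof (rule that[of \<V> F])
    show "closedin X (F V)" for V
      unfolding F_def
      by (rule closedin_Union_locally_finite_closure, rule locally_finite_in_subset[OF lfW]) auto
    have "topspace X \<subseteq> \<Union>(F ` \<V>)"
    proof
      fix x assume "x \<in> topspace X"
      then obtain W where "W \<in> \<W>" "x \<in> W" using covW by auto
      then have "x \<in> F (c W)"
        using closure_of_subset[OF openin_subset, of X W] opW by (auto simp: F_def)
      then show "x \<in> \<Union>(F ` \<V>)" using c \<open>W \<in> \<W>\<close> by auto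
    qed
    moreover show "F V \<subseteq> V" for V
      using c by (auto simp: F_def)
    ultimately show "\<Union>(F ` \<V>) = topspace X"
      using covV by blast
  qed (use opV refV lfV in auto)
qed

text \<open>The weights vanish off a closed subset of V, not merely off V. A local choice multiplied
  by its weight therefore vanishes near every point outside V, boundary points included.\<close>

lemma paracompact_partition_of_unity:
  assumes X: "paracompact_space X"
    and op: "\<And>U. U \<in> \<U> \<Longrightarrow> openin X U" and cov: "\<Union>\<U> = topspace X"
  obtains \<V> f where "\<And>V. V \<in> \<V> \<Longrightarrow> openin X V" "\<And>V. V \<in> \<V> \<Longrightarrow> \<exists>U\<in>\<U>. V \<subseteq> U"
    "locally_finite_in X \<V>"
    "\<And>V. V \<in> \<V> \<Longrightarrow> continuous_map X euclideanreal (f V)"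
    "\<And>V x. V \<in> \<V> \<Longrightarrow> x \<in> topspace X \<Longrightarrow> 0 \<le> f V x"
    "\<And>V. V \<in> \<V> \<Longrightarrow> \<exists>C. closedin X C \<and> C \<subseteq> V \<and> (\<forall>x \<in> topspace X - C. f V x = 0)"
    "\<And>x. x \<in> topspace X \<Longrightarrow> finite {V \<in> \<V>. x \<in> V} \<and> (\<Sum>V | V \<in> \<V> \<and> x \<in> V. f V x) = (1::real)"
proof -
  obtain \<V> F where opV: "\<And>V. V \<in> \<V> \<Longrightarrow> openin X V" and ref: "\<And>V. V \<in> \<V> \<Longrightarrow> \<exists>U\<in>\<U>. V \<subseteq> U"
    and lf: "locally_finite_in X \<V>" and clF: "\<And>V. V \<in> \<V> \<Longrightarrow> closedin X (F V)"
    and FV: "\<And>V. V \<in> \<V> \<Longrightarrow> F V \<subseteq> V" and covF: "\<Union>(F ` \<V>) = topspace X"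
    using paracompact_closed_shrinking[OF X op cov] by metis
  have g_ex: "\<exists>g. continuous_map X (top_of_set {0..1::real}) g \<and> g ` (topspace X - V) \<subseteq> {0} \<and> g ` F V \<subseteq> {1}"
    if "V \<in> \<V>" for V
  proof -
    have "closedin X (topspace X - V)" "disjnt (topspace X - V) (F V)"
      using opV[OF that] FV[OF that] by (auto simp: disjnt_def)
    then show ?thesis
      using Urysohn_lemma[OF paracompact_imp_normal_space[OF X] _ clF[OF that], of "topspace X - V" 0 1]
      by (metis zero_le_one)
  qed
  then obtain h where h: "\<And>V. V \<in> \<V> \<Longrightarrow> continuous_map X (top_of_set {0..1::real}) (h V)"
    "\<And>V. V \<in> \<V> \<Longrightarrow> h V ` (topspace X - V) \<subseteq> {0}" "\<And>V. V \<in> \<V> \<Longrightarrow> h V ` F V \<subseteq> {1}"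
    by metis
  have hc: "continuous_map X euclideanreal (h V)" if "V \<in> \<V>" for V
    using h(1)[OF that] by (simp add: continuous_map_in_subtopology)
  \<comment> \<open>The support of \<open>h V\<close> may reach the boundary of V. Cutting at height
    1/2 confines it to the closed set where \<open>h V\<close> is at least 1/2, which lies in V, and
    keeps the value 1 on \<open>F V\<close>.\<close>
  define g where "g V x = max 0 (2 * h V x - 1)" for V x
  have gc: "continuous_map X euclideanreal (g V)" if "V \<in> \<V>" for V
    unfolding g_def using hc[OF that] by (intro continuous_intros)
  have g0: "0 \<le> g V x" for V x
    by (simp add: g_def)
  have g1: "g V x = 1" if "V \<in> \<V>" "x \<in> F V" for V x
    using h(3)[OF that(1)] that(2) by (fastforce simp: g_def)
  have gC: "\<exists>C. closedin X C \<and> C \<subseteq> V \<and> (\<forall>x \<in> topspace X - C. g V x = 0)" if V: "V \<in> \<V>" for V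
  proof (intro exI conjI)
    show "closedin X {x \<in> topspace X. h V x \<in> {1/2..}}"
      by (rule closedin_continuous_map_preimage[OF hc[OF V]]) auto
    show "{x \<in> topspace X. h V x \<in> {1/2..}} \<subseteq> V"
      using h(2)[OF V] by fastforce
  qed (auto simp: g_def)
  have gz: "g V x = 0" if "V \<in> \<V>" "x \<in> topspace X" "x \<notin> V" for V x
    using gC[OF that(1)] that by blast
  define s where "s x = (\<Sum>V | V \<in> \<V> \<and> x \<in> V. g V x)" for x
  have fin: "\<exists>N. openin X N \<and> x \<in> N \<and> finite {V \<in> \<V>. V \<inter> N \<noteq> {}}" if "x \<in> topspace X" for x
    using lf that by (auto simp: locally_finite_in_def)
  have finx: "finite {V \<in> \<V>. x \<in> V}" if x: "x \<in> topspace X" for x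
    using fin[OF x] by (elim exE conjE) (erule rev_finite_subset, auto)
  have scont: "continuous_map X euclideanreal s"
  proof (rule continuous_map_if_locally)
    fix x assume "x \<in> topspace X"
    then obtain N where N: "openin X N" "x \<in> N" "finite {V \<in> \<V>. V \<inter> N \<noteq> {}}"
      using fin by blast
    \<comment> \<open>The index set in \<open>s\<close> varies with the point; on N it can be
      replaced by a fixed finite one, since the added terms are zero.\<close>
    have "continuous_map (subtopology X N) euclideanreal (\<lambda>y. \<Sum>V | V \<in> \<V> \<and> V \<inter> N \<noteq> {}. g V y)"
      by (rule continuous_map_sum) (use N gc in \<open>auto intro: continuous_map_from_subtopology\<close>)
    moreover have "s y = (\<Sum>V | V \<in> \<V> \<and> V \<inter> N \<noteq> {}. g V y)" if y: "y \<in> N" for y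
      unfolding s_def
      by (rule sum.mono_neutral_left) (use N y gz openin_subset in \<open>auto dest: openin_subset\<close>)
    ultimately have "continuous_map (subtopology X N) euclideanreal s"
      by (auto elim!: continuous_map_eq)
    with N show "\<exists>N. openin X N \<and> x \<in> N \<and> continuous_map (subtopology X N) euclideanreal s" by blast
  qed
  have spos: "0 < s x" if x: "x \<in> topspace X" for x
  proof -
    obtain V where V: "V \<in> \<V>" "x \<in> F V" using x covF by auto
    then have "g V x = 1" using g1 by blast
    then show ?thesis
      unfolding s_def using V FV x g0
      by (intro sum_pos2[of _ V]) (auto intro: finx)
  qed
  show ?thesis
  proof (rule that[of \<V> "\<lambda>V x. g V x / s x"])
    fix x assume x: "x \<in> topspace X"
    show "finite {V \<in> \<V>. x \<in> V} \<and> (\<Sum>V | V \<in> \<V> \<and> x \<in> V. g V x / s x) = 1"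
      using spos[OF x] finx[OF x] by (simp flip: sum_divide_distrib s_def)
  next
    fix V assume V: "V \<in> \<V>"
    show "continuous_map X euclideanreal (\<lambda>x. g V x / s x)"
      by (rule continuous_map_real_divide) (use V gc scont spos in force)+
    show "\<exists>C. closedin X C \<and> C \<subseteq> V \<and> (\<forall>x \<in> topspace X - C. g V x / s x = 0)"
      using gC[OF V] by (metis div_0)
  qed (use opV ref lf g0 spos in \<open>auto simp: less_imp_le\<close>)
qed

section \<open>Fiberwise arithmetic and neighbourhoods in a Banach bundle\<close>


locale normed_fiber = banach_space_on +
  assumes K_cases: "K = \<real> \<or> K = UNIV"
begin

lemma K_one: "1 \<in> K" and K_zero: "0 \<in> K" and K_neg_one: "-1 \<in> K"
  using K_cases by auto

lemmas closed = zero_closed add_closed scale_closed K_neg_one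

lemma scale_zero_left: "x \<in> V \<Longrightarrow> scale 0 x = zero"
  using nrm_scale[OF K_zero, of x] nrm_eq_zero[OF scale_closed[OF K_zero, of x]] by simp

lemma scale_zero_right: "c \<in> K \<Longrightarrow> scale c zero = zero"
  using nrm_scale[of c zero] nrm_eq_zero[OF scale_closed, of c zero] nrm_eq_zero[OF zero_closed] zero_closed
  by simp

lemma add_neg: "x \<in> V \<Longrightarrow> add x (scale (-1) x) = zero"
  using add_scale[OF K_one K_neg_one, of x] by (simp add: scale_one scale_zero_left)

lemma zero_add: "x \<in> V \<Longrightarrow> add zero x = x"
  using add_commute[of zero x] add_zero[of x] zero_closed by simp

lemma add_left_commute: "\<lbrakk>x \<in> V; y \<in> V; z \<in> V\<rbrakk> \<Longrightarrow> add x (add y z) = add y (add x z)"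
  by (metis add_assoc add_commute)

lemmas add_ac = add_assoc add_commute add_left_commute

definition ndist :: "'a \<Rightarrow> 'a \<Rightarrow> real" where
  "ndist x y = nrm (add x (scale (-1) y))"

lemma ndist_nonneg: "\<lbrakk>x \<in> V; y \<in> V\<rbrakk> \<Longrightarrow> 0 \<le> ndist x y"
  by (simp add: ndist_def nrm_nonneg closed)

lemma ndist_self: "x \<in> V \<Longrightarrow> ndist x x = 0"
  by (simp add: ndist_def add_neg nrm_eq_zero closed)

lemma add_diff: "\<lbrakk>x \<in> V; y \<in> V\<rbrakk> \<Longrightarrow> add y (add x (scale (-1) y)) = x"
  by (simp add: add_left_commute[of y x] add_neg add_zero closed)

lemma ndist_eq_zero: "\<lbrakk>x \<in> V; y \<in> V\<rbrakk> \<Longrightarrow> ndist x y = 0 \<longleftrightarrow> x = y"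
  by (metis add_diff add_zero add_closed scale_closed K_neg_one ndist_def ndist_self nrm_eq_zero)

lemma ndist_commute: 
  assumes "x \<in> V" "y \<in> V" shows "ndist x y = ndist y x"
proof -
  have "scale (-1) (add y (scale (-1) x)) = add x (scale (-1) y)"
    using assms scale_add[OF K_neg_one, of y "scale (-1) x"] scale_scale[OF K_neg_one K_neg_one, of x]
    by (simp add: closed scale_one add_commute)
  then show ?thesis
    using nrm_scale[OF K_neg_one, of "add y (scale (-1) x)"] assms by (simp add: ndist_def closed)
qed

lemma ndist_triangle:
  assumes "x \<in> V" "y \<in> V" "z \<in> V" shows "ndist x z \<le> ndist x y + ndist y z"
proof -
  have "add (add x (scale (-1) y)) (add y (scale (-1) z)) = add x (add (add y (scale (-1) y)) (scale (-1) z))"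
    using assms by (simp add: add_ac closed)
  also have "\<dots> = add x (scale (-1) z)"
    using assms by (simp add: add_neg zero_add closed)
  finally show ?thesis
    using nrm_triangle[of "add x (scale (-1) y)" "add y (scale (-1) z)"] assms by (simp add: ndist_def closed)
qed

lemma ndist_add:
  assumes "x \<in> V" "y \<in> V" "x' \<in> V" "y' \<in> V"
  shows "ndist (add x y) (add x' y') \<le> ndist x x' + ndist y y'"
proof -
  have "add (add x y) (scale (-1) (add x' y')) = add (add x (scale (-1) x')) (add y (scale (-1) y'))"
    using assms by (simp add: add_ac scale_add closed)
  then show ?thesis
    using nrm_triangle[of "add x (scale (-1) x')" "add y (scale (-1) y')"] assms by (simp add: ndist_def closed)
qed

lemma ndist_scale:
  assumes "c \<in> K" "x \<in> V" "y \<in> V"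
  shows "ndist (scale c x) (scale c y) = cmod c * ndist x y"
proof -
  have "add (scale c x) (scale (-1) (scale c y)) = scale c (add x (scale (-1) y))"
    using assms by (simp add: scale_add scale_scale closed)
  then show ?thesis
    using assms by (simp add: ndist_def nrm_scale closed)
qed

lemma ndist_zero: "x \<in> V \<Longrightarrow> ndist x zero = nrm x"
  by (simp add: ndist_def scale_zero_right add_zero closed)

lemma ndist_add_self:
  assumes "x \<in> V" "z \<in> V" shows "ndist (add x z) x = nrm z"
proof -
  have "add (add x z) (scale (-1) x) = add (add x (scale (-1) x)) z"
    using assms by (simp add: add_ac closed)
  then show ?thesis
    using assms by (simp add: ndist_def add_neg zero_add closed)
qed

lemma nrm_le_ndist: "\<lbrakk>x \<in> V; y \<in> V\<rbrakk> \<Longrightarrow> nrm x \<le> nrm y + ndist x y"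
  using ndist_triangle[of x y zero] by (simp add: ndist_zero closed)

text \<open>Completeness in the form used later: one limit l inherits every bound on a tail, by
  letting k tend to infinity in the triangle inequality. Bounds that are uniform in a parameter thus
  pass to pointwise limits.\<close>

lemma limit_exists:
  assumes \<sigma>: "\<And>n::nat. \<sigma> n \<in> V"
    and cauchy: "\<And>e. 0 < e \<Longrightarrow> \<exists>N. \<forall>k. ndist (\<sigma> (N + k)) (\<sigma> N) \<le> e"
  shows "\<exists>l\<in>V. \<forall>N e. (\<forall>k. ndist (\<sigma> (N + k)) (\<sigma> N) \<le> e) \<longrightarrow> ndist l (\<sigma> N) \<le> e"
proof -
  have "\<exists>N. \<forall>m\<ge>N. \<forall>n\<ge>N. nrm (add (\<sigma> m) (scale (-1) (\<sigma> n))) < e" if e: "0 < e" for e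
  proof -
    obtain N where N: "\<And>k. ndist (\<sigma> (N + k)) (\<sigma> N) \<le> e / 3"
      using cauchy[of "e / 3"] e by auto
    have "ndist (\<sigma> m) (\<sigma> n) < e" if "m \<ge> N" "n \<ge> N" for m n
    proof -
      have "ndist (\<sigma> m) (\<sigma> N) \<le> e / 3" "ndist (\<sigma> n) (\<sigma> N) \<le> e / 3"
        using N[of "m - N"] N[of "n - N"] that by simp_all
      then show ?thesis
        using ndist_triangle[of "\<sigma> m" "\<sigma> N" "\<sigma> n"] ndist_commute[of "\<sigma> N" "\<sigma> n"] \<sigma> e by auto
    qed
    then show ?thesis by (auto simp: ndist_def)
  qed
  then obtain l where l: "l \<in> V" "(\<lambda>n. ndist (\<sigma> n) l) \<longlonglongrightarrow> 0"
    using cauchy_converges[of \<sigma>, OF \<sigma>] by (auto simp: ndist_def)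
  have "ndist l (\<sigma> N) \<le> e" if b: "\<forall>k. ndist (\<sigma> (N + k)) (\<sigma> N) \<le> e" for N e
  proof (rule LIMSEQ_le_const)
    show "(\<lambda>k. ndist (\<sigma> (k + N)) l + e) \<longlonglongrightarrow> e"
      using tendsto_add[OF LIMSEQ_ignore_initial_segment[OF l(2), of N] tendsto_const[of e]] by simp
    show "\<exists>n. \<forall>k\<ge>n. ndist l (\<sigma> N) \<le> ndist (\<sigma> (k + N)) l + e"
    proof (intro exI allI impI)
      fix k
      show "ndist l (\<sigma> N) \<le> ndist (\<sigma> (k + N)) l + e"
        using ndist_triangle[of l "\<sigma> (k + N)" "\<sigma> N"] ndist_commute[of l "\<sigma> (k + N)"] \<sigma> l(1)
          b[rule_format, of k] by (simp add: add.commute)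
    qed
  qed
  with l show ?thesis by auto
qed

text \<open>The finite product of the commutative monoid on the carrier V, read additively.\<close>

definition fsum :: "('i \<Rightarrow> 'a) \<Rightarrow> 'i set \<Rightarrow> 'a" where
  "fsum g I = finprod \<lparr>carrier = V, mult = add, one = zero\<rparr> g I"

lemma comm_monoid_fiber: "comm_monoid \<lparr>carrier = V, mult = add, one = zero\<rparr>"
  by (rule comm_monoidI) (simp_all add: closed add_zero zero_add add_ac)

lemma fsum_empty: "fsum g {} = zero"
  using comm_monoid.finprod_empty[OF comm_monoid_fiber] by (simp add: fsum_def)

lemma fsum_insert:
  "\<lbrakk>finite I; i \<notin> I; \<And>j. j \<in> insert i I \<Longrightarrow> g j \<in> V\<rbrakk> \<Longrightarrow> fsum g (insert i I) = add (g i) (fsum g I)"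
  using comm_monoid.finprod_insert[OF comm_monoid_fiber, of I i g] by (simp add: fsum_def Pi_def)

lemma fsum_closed: "(\<And>j. j \<in> I \<Longrightarrow> g j \<in> V) \<Longrightarrow> fsum g I \<in> V"
  using comm_monoid.finprod_closed[OF comm_monoid_fiber, of g I] by (simp add: fsum_def Pi_def)

lemma fsum_mono_neutral:
  "\<lbrakk>finite J; I \<subseteq> J; \<And>i. i \<in> J - I \<Longrightarrow> g i = zero; \<And>j. j \<in> J \<Longrightarrow> g j \<in> V\<rbrakk> \<Longrightarrow> fsum g I = fsum g J"
  using comm_monoid.finprod_mono_neutral_cong_left[OF comm_monoid_fiber, of J I g g]
  by (simp add: fsum_def Pi_def)

end

text \<open>The norm distance of a fiber; it has this meaning only for two points over the same base
  point.\<close>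

definition fdist :: "('e, 'b) bundle_data \<Rightarrow> 'e \<Rightarrow> 'e \<Rightarrow> real" where
  "fdist \<xi> x y = fnorm \<xi> (fadd \<xi> x (fscale \<xi> (-1) y))"

locale scalar_bundle = banach_bundle +
  assumes scalars: "K = \<real> \<or> K = UNIV"
begin

abbreviation "E \<equiv> topspace (bspace \<xi>)"
abbreviation "p \<equiv> proj \<xi>"
abbreviation "is_open \<equiv> openin (bspace \<xi>)"

lemma normed_fiber: "t \<in> topspace (base \<xi>) \<Longrightarrow>
    normed_fiber K (fiber \<xi> t) (fadd \<xi>) (fscale \<xi>) (fzero \<xi> t) (fnorm \<xi>)"
  by (simp add: normed_fiber_def normed_fiber_axioms_def fiber_banach scalars)

lemma p_base: "x \<in> E \<Longrightarrow> p x \<in> topspace (base \<xi>)"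
  using proj_surj by auto

lemma fib: "x \<in> E \<Longrightarrow> normed_fiber K (fiber \<xi> (p x)) (fadd \<xi>) (fscale \<xi>) (fzero \<xi> (p x)) (fnorm \<xi>)"
  by (simp add: p_base normed_fiber)

lemma fdist_eq: "x \<in> E \<Longrightarrow> 
    normed_fiber.ndist (fadd \<xi>) (fscale \<xi>) (fnorm \<xi>) = fdist \<xi>"
  using normed_fiber.ndist_def[OF fib] by (auto simp: fdist_def fun_eq_iff)

lemma K_simps [simp]: "complex_of_real r \<in> K" "1 \<in> K" "0 \<in> K" "-1 \<in> K"
  using scalars by auto

lemma zero_E: "t \<in> topspace (base \<xi>) \<Longrightarrow> fzero \<xi> t \<in> E"
  and zero_p: "t \<in> topspace (base \<xi>) \<Longrightarrow> p (fzero \<xi> t) = t"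
  and norm_zero: "t \<in> topspace (base \<xi>) \<Longrightarrow> fnorm \<xi> (fzero \<xi> t) = 0"
  using banach_space_on.zero_closed[OF fiber_banach] banach_space_on.nrm_eq_zero[OF fiber_banach]
  by (auto simp: fiber_def)

lemma add_E: "\<lbrakk>x \<in> E; y \<in> E; p x = p y\<rbrakk> \<Longrightarrow> fadd \<xi> x y \<in> E"
  and add_p: "\<lbrakk>x \<in> E; y \<in> E; p x = p y\<rbrakk> \<Longrightarrow> p (fadd \<xi> x y) = p y"
  using normed_fiber.closed(2)[OF fib, of x x y] by (auto simp: fiber_def)

lemma scale_E: "\<lbrakk>c \<in> K; x \<in> E\<rbrakk> \<Longrightarrow> fscale \<xi> c x \<in> E"
  and scale_p: "\<lbrakk>c \<in> K; x \<in> E\<rbrakk> \<Longrightarrow> p (fscale \<xi> c x) = p x"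
  using normed_fiber.closed(3)[OF fib, of x c x] by (auto simp: fiber_def)

lemmas E_p = zero_E zero_p add_E add_p scale_E scale_p p_base

lemma norm_nonneg: "x \<in> E \<Longrightarrow> 0 \<le> fnorm \<xi> x"
  using banach_space_on.nrm_nonneg[OF fiber_banach[OF p_base], of x x] by (simp add: fiber_def)

lemma norm_eq_0: "x \<in> E \<Longrightarrow> fnorm \<xi> x = 0 \<longleftrightarrow> x = fzero \<xi> (p x)"
  using banach_space_on.nrm_eq_zero[OF fiber_banach[OF p_base], of x x] by (simp add: fiber_def)

lemma norm_scale: "\<lbrakk>c \<in> K; x \<in> E\<rbrakk> \<Longrightarrow> fnorm \<xi> (fscale \<xi> c x) = cmod c * fnorm \<xi> x"
  using banach_space_on.nrm_scale[OF fiber_banach[OF p_base], of x c x] by (simp add: fiber_def)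

lemma scale_scale: "\<lbrakk>c \<in> K; d \<in> K; x \<in> E\<rbrakk> \<Longrightarrow> fscale \<xi> c (fscale \<xi> d x) = fscale \<xi> (c * d) x"
  using banach_space_on.scale_scale[OF fiber_banach[OF p_base], of x c d x] by (simp add: fiber_def)

lemma scale_one: "x \<in> E \<Longrightarrow> fscale \<xi> 1 x = x"
  using banach_space_on.scale_one[OF fiber_banach[OF p_base], of x x] by (simp add: fiber_def)

lemma scale_0: "x \<in> E \<Longrightarrow> fscale \<xi> 0 x = fzero \<xi> (p x)"
  using normed_fiber.scale_zero_left[OF fib, of x x] by (simp add: fiber_def)

lemma scale_zero: "\<lbrakk>c \<in> K; t \<in> topspace (base \<xi>)\<rbrakk> \<Longrightarrow> fscale \<xi> c (fzero \<xi> t) = fzero \<xi> t"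
  using normed_fiber.scale_zero_right[OF normed_fiber] by blast

lemma scale_add: "\<lbrakk>c \<in> K; x \<in> E; y \<in> E; p x = p y\<rbrakk> \<Longrightarrow>
    fscale \<xi> c (fadd \<xi> x y) = fadd \<xi> (fscale \<xi> c x) (fscale \<xi> c y)"
  using banach_space_on.scale_add[OF fiber_banach[OF p_base], of x c x y] by (simp add: fiber_def)

lemma add_scale: "\<lbrakk>c \<in> K; d \<in> K; x \<in> E\<rbrakk> \<Longrightarrow>
    fscale \<xi> (c + d) x = fadd \<xi> (fscale \<xi> c x) (fscale \<xi> d x)"
  using banach_space_on.add_scale[OF fiber_banach[OF p_base], of x c d x] by (simp add: fiber_def)

lemma add_commute: "\<lbrakk>x \<in> E; y \<in> E; p x = p y\<rbrakk> \<Longrightarrow> fadd \<xi> x y = fadd \<xi> y x"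
  using banach_space_on.add_commute[OF fiber_banach[OF p_base], of x x y] by (simp add: fiber_def)

lemma add_neg: "x \<in> E \<Longrightarrow> fadd \<xi> x (fscale \<xi> (-1) x) = fzero \<xi> (p x)"
  using normed_fiber.add_neg[OF fib, of x x] by (simp add: fiber_def)

lemma add_diff: "\<lbrakk>x \<in> E; y \<in> E; p x = p y\<rbrakk> \<Longrightarrow> fadd \<xi> y (fadd \<xi> x (fscale \<xi> (-1) y)) = x"
  using normed_fiber.add_diff[OF fib, of x x y] by (simp add: fiber_def)

lemma fdist_nonneg: "\<lbrakk>x \<in> E; y \<in> E; p x = p y\<rbrakk> \<Longrightarrow> 0 \<le> fdist \<xi> x y"
  using normed_fiber.ndist_nonneg[OF fib, of x x y] by (simp add: fiber_def fdist_eq)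

lemma fdist_self: "x \<in> E \<Longrightarrow> fdist \<xi> x x = 0"
  using normed_fiber.ndist_self[OF fib, of x x] by (simp add: fiber_def fdist_eq)

lemma fdist_eq_0: "\<lbrakk>x \<in> E; y \<in> E; p x = p y\<rbrakk> \<Longrightarrow> fdist \<xi> x y = 0 \<longleftrightarrow> x = y"
  using normed_fiber.ndist_eq_zero[OF fib, of x x y] by (simp add: fiber_def fdist_eq)

lemma fdist_commute: "\<lbrakk>x \<in> E; y \<in> E; p x = p y\<rbrakk> \<Longrightarrow> fdist \<xi> x y = fdist \<xi> y x"
  using normed_fiber.ndist_commute[OF fib, of x x y] by (simp add: fiber_def fdist_eq)

lemma fdist_triangle: "\<lbrakk>x \<in> E; y \<in> E; z \<in> E; p x = p y; p y = p z\<rbrakk> \<Longrightarrow> fdist \<xi> x z \<le> fdist \<xi> x y + fdist \<xi> y z"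
  using normed_fiber.ndist_triangle[OF fib, of x x y z] by (simp add: fiber_def fdist_eq)

lemma fdist_add: "\<lbrakk>x \<in> E; y \<in> E; x' \<in> E; y' \<in> E; p x = p y; p x' = p y; p y' = p y\<rbrakk> \<Longrightarrow>
    fdist \<xi> (fadd \<xi> x y) (fadd \<xi> x' y') \<le> fdist \<xi> x x' + fdist \<xi> y y'"
  using normed_fiber.ndist_add[OF fib, of x x y x' y'] by (simp add: fiber_def fdist_eq)

lemma fdist_scale: "\<lbrakk>c \<in> K; x \<in> E; y \<in> E; p x = p y\<rbrakk> \<Longrightarrow>
    fdist \<xi> (fscale \<xi> c x) (fscale \<xi> c y) = cmod c * fdist \<xi> x y"
  using normed_fiber.ndist_scale[OF fib, of x c x y] by (simp add: fiber_def fdist_eq)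

lemma fdist_zero: "x \<in> E \<Longrightarrow> fdist \<xi> x (fzero \<xi> (p x)) = fnorm \<xi> x"
  using normed_fiber.ndist_zero[OF fib, of x x] by (simp add: fiber_def fdist_eq)

lemma fdist_add_self: "\<lbrakk>x \<in> E; z \<in> E; p x = p z\<rbrakk> \<Longrightarrow> fdist \<xi> (fadd \<xi> x z) x = fnorm \<xi> z"
  using normed_fiber.ndist_add_self[OF fib, of x x z] by (simp add: fiber_def fdist_eq)

lemma norm_le_dist: "\<lbrakk>x \<in> E; y \<in> E; p x = p y\<rbrakk> \<Longrightarrow> fnorm \<xi> x \<le> fnorm \<xi> y + fdist \<xi> x y"
  using normed_fiber.nrm_le_ndist[OF fib, of x x y] by (simp add: fiber_def fdist_eq)

lemma limit_exists:
  assumes t: "t \<in> topspace (base \<xi>)" and \<sigma>: "\<And>n::nat. \<sigma> n \<in> E" "\<And>n. p (\<sigma> n) = t"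
    and cauchy: "\<And>e. 0 < e \<Longrightarrow> \<exists>N. \<forall>k. fdist \<xi> (\<sigma> (N + k)) (\<sigma> N) \<le> e"
  shows "\<exists>l\<in>E. p l = t \<and>
    (\<forall>N e. (\<forall>k. fdist \<xi> (\<sigma> (N + k)) (\<sigma> N) \<le> e) \<longrightarrow> fdist \<xi> l (\<sigma> N) \<le> e)"
proof -
  have "\<exists>l\<in>fiber \<xi> t. \<forall>N e. (\<forall>k. fdist \<xi> (\<sigma> (N + k)) (\<sigma> N) \<le> e) \<longrightarrow> fdist \<xi> l (\<sigma> N) \<le> e"
    using normed_fiber.limit_exists[OF normed_fiber[OF t], of \<sigma>, unfolded fdist_eq[OF \<sigma>(1)[of 0]]] \<sigma> cauchy
    by (simp add: fiber_def)
  then show ?thesis by (auto simp: fiber_def)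
qed

section \<open>Neighbourhood forms of the bundle axioms\<close>

lemma add_nbhd:
  assumes S: "is_open S" and x: "x \<in> E" and y: "y \<in> E" and pxy: "p x = p y" and xy: "fadd \<xi> x y \<in> S"
  shows "\<exists>A B. is_open A \<and> x \<in> A \<and> is_open B \<and> y \<in> B \<and> (\<forall>a\<in>A. \<forall>b\<in>B. p a = p b \<longrightarrow> fadd \<xi> a b \<in> S)"
proof -
  have "openin (subtopology (prod_topology (bspace \<xi>) (bspace \<xi>)) {(x, y). p x = p y})
    {z \<in> topspace (subtopology (prod_topology (bspace \<xi>) (bspace \<xi>)) {(x, y). p x = p y}).
      (case z of (x, y) \<Rightarrow> fadd \<xi> x y) \<in> S}"
    using openin_continuous_map_preimage[OF add_continuous S] .
  then obtain T where T: "openin (prod_topology (bspace \<xi>) (bspace \<xi>)) T"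
    "\<And>a b. \<lbrakk>a \<in> E; b \<in> E; p a = p b\<rbrakk> \<Longrightarrow> fadd \<xi> a b \<in> S \<longleftrightarrow> (a, b) \<in> T"
    unfolding openin_subtopology by (auto simp: set_eq_iff)
  then have "(x, y) \<in> T" using assms by auto
  then obtain A B where AB: "is_open A" "is_open B" "x \<in> A" "y \<in> B" "A \<times> B \<subseteq> T"
    using T(1) unfolding openin_prod_topology_alt by meson
  have "fadd \<xi> a b \<in> S" if ab: "a \<in> A" "b \<in> B" "p a = p b" for a b
  proof -
    from ab AB have "a \<in> E" "b \<in> E" "(a, b) \<in> T" using openin_subset by blast+
    with T(2) ab show ?thesis by blast
  qed
  with AB(1-4) show ?thesis by blast
qed

lemma scale_nbhd:
  assumes S: "is_open S" and x: "x \<in> E" and c: "c \<in> K" and cx: "fscale \<xi> c x \<in> S"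
  shows "\<exists>d A. d > 0 \<and> is_open A \<and> x \<in> A \<and> (\<forall>k\<in>K. \<forall>a\<in>A. dist k c < d \<longrightarrow> fscale \<xi> k a \<in> S)"
proof -
  have "openin (prod_topology (top_of_set K) (bspace \<xi>))
    {z \<in> topspace (prod_topology (top_of_set K) (bspace \<xi>)). (case z of (c, x) \<Rightarrow> fscale \<xi> c x) \<in> S}"
    using openin_continuous_map_preimage[OF scale_continuous S] .
  moreover have "(c, x) \<in> {z \<in> topspace (prod_topology (top_of_set K) (bspace \<xi>)). (case z of (c, x) \<Rightarrow> fscale \<xi> c x) \<in> S}"
    using assms by auto
  ultimately obtain C A where CA: "openin (top_of_set K) C" "is_open A" "c \<in> C" "x \<in> A"
    "C \<times> A \<subseteq> {z \<in> topspace (prod_topology (top_of_set K) (bspace \<xi>)). (case z of (c, x) \<Rightarrow> fscale \<xi> c x) \<in> S}"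
    unfolding openin_prod_topology_alt by meson
  obtain d where d: "d > 0" "\<And>k. \<lbrakk>k \<in> K; dist k c < d\<rbrakk> \<Longrightarrow> k \<in> C"
    using CA(1,3) unfolding openin_euclidean_subtopology_iff by blast
  have "fscale \<xi> k a \<in> S" if "k \<in> K" "a \<in> A" "dist k c < d" for k a
    using subsetD[OF CA(5), of "(k, a)"] d(2)[OF that(1,3)] that by simp
  with CA(2,4) d(1) show ?thesis by blast
qed

lemma zero_nbhd:
  assumes S: "is_open S" and t: "t \<in> topspace (base \<xi>)" and zS: "fzero \<xi> t \<in> S"
  shows "\<exists>U e. openin (base \<xi>) U \<and> t \<in> U \<and> e > 0 \<and> (\<forall>z\<in>E. p z \<in> U \<longrightarrow> fnorm \<xi> z < e \<longrightarrow> z \<in> S)"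
proof -
  \<comment> \<open>The largest filter on the bundle space along which the projection tends to t and
    the norm to 0. For it, convergence to the zero vector amounts to a statement about basic
    neighbourhoods.\<close>
  define F where "F = inf (filtercomap p (nhdsin (base \<xi>) t))
    (inf (filtercomap (fnorm \<xi>) (nhds 0)) (principal E))"
  have lim: "filterlim p (nhdsin (base \<xi>) t) F"
    unfolding filterlim_iff_le_filtercomap F_def by simp
  have "limitin (base \<xi>) p t F"
    unfolding limitin_def
  proof (intro conjI allI impI)
    fix U assume "openin (base \<xi>) U \<and> t \<in> U"
    then have "eventually (\<lambda>s. s \<in> U) (nhdsin (base \<xi>) t)"
      unfolding eventually_nhdsin by blast
    then show "eventually (\<lambda>x. p x \<in> U) F"
      using lim unfolding filterlim_iff by blast
  qed (rule t)
  moreover have "(fnorm \<xi> \<longlongrightarrow> 0) F"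
    unfolding filterlim_iff_le_filtercomap F_def by (simp add: le_infI2)
  moreover have "eventually (\<lambda>x. x \<in> E) F"
    by (simp add: F_def eventually_inf_principal flip: inf_assoc)
  ultimately have "limitin (bspace \<xi>) (\<lambda>x. x) (fzero \<xi> t) F"
    using tendsto_zero by blast
  then have "eventually (\<lambda>x. x \<in> S) F"
    using S zS by (auto simp: limitin_def)
  then have "eventually (\<lambda>x. x \<in> E \<longrightarrow> x \<in> S) (inf (filtercomap p (nhdsin (base \<xi>) t)) (filtercomap (fnorm \<xi>) (nhds 0)))"
    by (simp add: F_def eventually_inf_principal flip: inf_assoc)
  then obtain P Q where PQ: "eventually P (nhdsin (base \<xi>) t)" "eventually Q (nhds (0::real))"
    "\<And>x. P (p x) \<Longrightarrow> Q (fnorm \<xi> x) \<Longrightarrow> x \<in> E \<Longrightarrow> x \<in> S"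
    unfolding eventually_inf eventually_filtercomap by metis
  obtain U where U: "openin (base \<xi>) U" "t \<in> U" "\<forall>u\<in>U. P u"
    using PQ(1) t by (auto simp: eventually_nhdsin)
  obtain e where e: "e > 0" "\<And>r. dist r 0 < e \<Longrightarrow> Q r"
    using PQ(2) unfolding eventually_nhds_metric by blast
  have "z \<in> S" if "z \<in> E" "p z \<in> U" "fnorm \<xi> z < e" for z
    using PQ(3) U(3) e(2)[of "fnorm \<xi> z"] norm_nonneg that by simp
  with U(1,2) e(1) show ?thesis by blast
qed

text \<open>Subtraction is continuous on pairs over a common base point and norm < e is an open
  condition, so the fiber distance is upper semicontinuous.\<close>

lemma fdist_nbhd:
  assumes x: "x \<in> E" and y: "y \<in> E" and "p x = p y" "fdist \<xi> x y < e"
  shows "\<exists>A B. is_open A \<and> x \<in> A \<and> is_open B \<and> y \<in> B \<and> (\<forall>a\<in>A. \<forall>b\<in>B. p a = p b \<longrightarrow> fdist \<xi> a b < e)"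
proof -
  have xy: "fadd \<xi> x (fscale \<xi> (-1) y) \<in> {z \<in> E. fnorm \<xi> z < e}"
    and y': "fscale \<xi> (-1) y \<in> E" "p x = p (fscale \<xi> (-1) y)"
    using assms by (simp_all add: E_p fdist_def)
  obtain A B where AB: "is_open A" "x \<in> A" "is_open B" "fscale \<xi> (-1) y \<in> B"
    "\<forall>a\<in>A. \<forall>b\<in>B. p a = p b \<longrightarrow> fadd \<xi> a b \<in> {z \<in> E. fnorm \<xi> z < e}"
    using add_nbhd[OF norm_usc x y' xy] by blast
  obtain d C where C: "d > 0" "is_open C" "y \<in> C"
    "\<forall>k\<in>K. \<forall>a\<in>C. dist k (-1) < d \<longrightarrow> fscale \<xi> k a \<in> B"
    using scale_nbhd[OF AB(3) y K_simps(4) AB(4)] by blast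
  have "fdist \<xi> a c < e" if "a \<in> A" "c \<in> C" "p a = p c" for a c
  proof -
    have "c \<in> E" using C(2) that openin_subset by blast
    then show ?thesis
      using AB(5) C(1,4) that by (simp add: fdist_def scale_p)
  qed
  with AB(1,2) C(2,3) show ?thesis by blast
qed

text \<open>The distance vanishes on the diagonal and is therefore small near it. Thin open sets
  play the part of norm balls around a local section.\<close>

lemma thin_nbhd:
  assumes x: "x \<in> E" and e: "0 < e"
  shows "\<exists>A. is_open A \<and> x \<in> A \<and> (\<forall>a\<in>A. \<forall>b\<in>A. p a = p b \<longrightarrow> fdist \<xi> a b < e)"
proof -
  obtain A B where "is_open A" "x \<in> A" "is_open B" "x \<in> B"
    "\<forall>a\<in>A. \<forall>b\<in>B. p a = p b \<longrightarrow> fdist \<xi> a b < e"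
    using fdist_nbhd[OF x x refl, of e] fdist_self[OF x] e by auto
  then show ?thesis by (intro exI[of _ "A \<inter> B"]) auto
qed

text \<open>Write y = a + (y - a): addition is continuous at the pair (x, 0), and
  \<open>zero_nbhd\<close> places all short vectors over nearby base points in the second
  neighbourhood. As e is uniform over A, fiberwise norm estimates control the topology of the bundle
  space.\<close>

lemma tube_nbhd:
  assumes S: "is_open S" and xS: "x \<in> S"
  shows "\<exists>A e. is_open A \<and> x \<in> A \<and> A \<subseteq> S \<and> e > 0 \<and>
    (\<forall>a\<in>A. \<forall>y\<in>E. p y = p a \<longrightarrow> fdist \<xi> y a < e \<longrightarrow> y \<in> S)"
proof -
  have x: "x \<in> E" using S xS openin_subset by blast
  have z: "fzero \<xi> (p x) \<in> E" "p x = p (fzero \<xi> (p x))"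
    using x by (simp_all add: E_p)
  have xz: "fadd \<xi> x (fzero \<xi> (p x)) \<in> S"
    using banach_space_on.add_zero[OF fiber_banach[OF p_base[OF x]], of x] x xS by (simp add: fiber_def)
  obtain A B where AB: "is_open A" "x \<in> A" "is_open B" "fzero \<xi> (p x) \<in> B"
    "\<forall>a\<in>A. \<forall>b\<in>B. p a = p b \<longrightarrow> fadd \<xi> a b \<in> S"
    using add_nbhd[OF S x z xz] by blast
  obtain U e where U: "openin (base \<xi>) U" "p x \<in> U" "e > 0"
    "\<forall>z\<in>E. p z \<in> U \<longrightarrow> fnorm \<xi> z < e \<longrightarrow> z \<in> B"
    using zero_nbhd[OF AB(3) p_base[OF x] AB(4)] by blast
  define C where "C = A \<inter> S \<inter> {a \<in> E. p a \<in> U}"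
  have "is_open C"
    unfolding C_def by (intro openin_Int AB S openin_continuous_map_preimage[OF proj_continuous U(1)])
  moreover have "x \<in> C" using AB xS x U by (simp add: C_def)
  moreover have "y \<in> S" if "a \<in> C" "y \<in> E" "p y = p a" "fdist \<xi> y a < e" for a y
  proof -
    have a: "a \<in> E" "a \<in> A" "p a \<in> U" using that by (auto simp: C_def)
    then have "fadd \<xi> y (fscale \<xi> (-1) a) \<in> B"
      using U(4) that by (simp add: E_p fdist_def)
    then show ?thesis
      using AB(5)[rule_format, OF a(2), of "fadd \<xi> y (fscale \<xi> (-1) a)"] that a by (simp add: E_p add_diff)
  qed
  moreover have "C \<subseteq> S" by (auto simp: C_def)
  ultimately show ?thesis using U(3) by blast
qed

end

section \<open>Nearly continuous maps into a bundle\<close>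


text \<open>Continuity of h at a up to a fiberwise error: \<open>h y\<close> need not enter S, only
  come within \<open>e y\<close> of a point of S in its own fiber. The error is a function because
  patching multiplies local errors by the weights of a partition of unity.\<close>

definition near_cont :: "('e, 'b) bundle_data \<Rightarrow> 'x topology \<Rightarrow> ('x \<Rightarrow> real) \<Rightarrow> ('x \<Rightarrow> 'e) \<Rightarrow> 'x \<Rightarrow> bool" where
  "near_cont \<xi> X e h a \<longleftrightarrow> (\<forall>S. openin (bspace \<xi>) S \<and> h a \<in> S \<longrightarrow>
     (\<forall>\<^sub>F y in nhdsin X a. \<exists>x\<in>S. proj \<xi> x = proj \<xi> (h y) \<and> fdist \<xi> (h y) x \<le> e y))"

lemma eventually_nhdsin_topspace: "\<forall>\<^sub>F y in nhdsin X a. y \<in> topspace X"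
  unfolding eventually_nhdsin by blast

lemma eventually_nhdsin_open: "openin X W \<Longrightarrow> a \<in> W \<Longrightarrow> \<forall>\<^sub>F y in nhdsin X a. y \<in> W"
  unfolding eventually_nhdsin by blast

lemma eventually_nhdsin_continuous:
  "\<lbrakk>continuous_map X Y f; openin Y S; a \<in> topspace X; f a \<in> S\<rbrakk> \<Longrightarrow> \<forall>\<^sub>F y in nhdsin X a. f y \<in> S"
  using eventually_nhdsin_open[OF openin_continuous_map_preimage, of X Y f S a]
  by (auto elim: eventually_mono)

lemma continuous_map_if_eventually:
  assumes "\<And>y. y \<in> topspace X \<Longrightarrow> h y \<in> topspace Y"
    and ev: "\<And>a S. \<lbrakk>a \<in> topspace X; openin Y S; h a \<in> S\<rbrakk> \<Longrightarrow> \<forall>\<^sub>F y in nhdsin X a. h y \<in> S"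
  shows "continuous_map X Y h"
  unfolding continuous_map
proof (intro conjI allI impI)
  show "h ` topspace X \<subseteq> topspace Y" using assms by auto
  fix S assume S: "openin Y S"
  show "openin X {x \<in> topspace X. h x \<in> S}"
  proof (subst openin_subopen, intro ballI)
    fix a assume a: "a \<in> {x \<in> topspace X. h x \<in> S}"
    then obtain W where "openin X W" "a \<in> W" "\<forall>y\<in>W. h y \<in> S"
      using ev[of a S] S by (auto simp: eventually_nhdsin)
    then show "\<exists>T. openin X T \<and> a \<in> T \<and> T \<subseteq> {x \<in> topspace X. h x \<in> S}"
      using openin_subset by blast
  qed
qed

context scalar_bundle
begin

lemma open_E: "is_open S \<Longrightarrow> x \<in> S \<Longrightarrow> x \<in> E"
  using openin_subset by blast

lemma near_cont_continuous:
  assumes h: "continuous_map X (bspace \<xi>) h" and a: "a \<in> topspace X" and e: "\<And>y. 0 \<le> e y"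
  shows "near_cont \<xi> X e h a"
  unfolding near_cont_def
proof (intro allI impI)
  fix S assume S: "is_open S \<and> h a \<in> S"
  then have "\<forall>\<^sub>F y in nhdsin X a. h y \<in> S"
    using eventually_nhdsin_continuous[OF h _ a] by blast
  then show "\<forall>\<^sub>F y in nhdsin X a. \<exists>x\<in>S. p x = p (h y) \<and> fdist \<xi> (h y) x \<le> e y"
    by eventually_elim (use S e fdist_self open_E in force)
qed

text \<open>By \<open>tube_nbhd\<close>, being close enough to a smaller neighbourhood A means being
  in S. The error e / 2 turns the weak inequality of \<open>near_cont\<close> into the strict one
  required there.\<close>

lemma continuous_if_near_cont:
  assumes h: "\<And>y. y \<in> topspace X \<Longrightarrow> h y \<in> E"
    and nc: "\<And>a e. \<lbrakk>a \<in> topspace X; e > 0\<rbrakk> \<Longrightarrow> near_cont \<xi> X (\<lambda>_. e) h a"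
  shows "continuous_map X (bspace \<xi>) h"
proof (rule continuous_map_if_eventually[OF h])
  fix a S assume a: "a \<in> topspace X" and S: "is_open S" "h a \<in> S"
  obtain A e where A: "is_open A" "h a \<in> A" "e > 0"
    "\<forall>b\<in>A. \<forall>y\<in>E. p y = p b \<longrightarrow> fdist \<xi> y b < e \<longrightarrow> y \<in> S"
    using tube_nbhd[OF S] by blast
  have "\<forall>\<^sub>F y in nhdsin X a. \<exists>x\<in>A. p x = p (h y) \<and> fdist \<xi> (h y) x \<le> e / 2"
    using nc[OF a, of "e / 2"] A by (auto simp: near_cont_def)
  with eventually_nhdsin_topspace show "\<forall>\<^sub>F y in nhdsin X a. h y \<in> S"
  proof eventually_elim
    case (elim y)
    then obtain x where "x \<in> A" "p x = p (h y)" "fdist \<xi> (h y) x \<le> e / 2" by blast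
    with A(3,4) h[OF elim(1)] show ?case by (smt (verit) field_sum_of_halves)
  qed
qed

lemma near_cont_mono:
  assumes nf: "near_cont \<xi> X d f a" and a: "a \<in> topspace X"
    and ev: "\<forall>\<^sub>F y in nhdsin X a. f y = h y \<and> d y \<le> e y"
  shows "near_cont \<xi> X e h a"
  unfolding near_cont_def
proof (intro allI impI)
  fix S assume S: "is_open S \<and> h a \<in> S"
  \<comment> \<open>Neighbourhoods in \<open>nhdsin\<close> contain a itself, so eventual equality
    includes equality at a.\<close>
  moreover have "f a = h a"
    using ev a unfolding eventually_nhdsin by blast
  ultimately have "\<forall>\<^sub>F y in nhdsin X a. \<exists>x\<in>S. p x = p (f y) \<and> fdist \<xi> (f y) x \<le> d y"
    using nf by (simp add: near_cont_def)
  with ev show "\<forall>\<^sub>F y in nhdsin X a. \<exists>x\<in>S. p x = p (h y) \<and> fdist \<xi> (h y) x \<le> e y"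
    by eventually_elim force
qed

text \<open>This replaces the uniform limit theorem. With z = h(a) - f(a), of norm at most e, the
  vectors near z of norm < 2 e form an open set, which meets all nearby fibers because the
  projection is open. Adding such a w to a point x near \<open>f y\<close> lands in S, and the
  distance from \<open>h y\<close> is at most e + e + 2 e.\<close>

lemma near_cont_perturb:
  assumes f: "\<And>y. y \<in> topspace X \<Longrightarrow> f y \<in> E" and h: "\<And>y. y \<in> topspace X \<Longrightarrow> h y \<in> E"
    and pf: "\<And>y. y \<in> topspace X \<Longrightarrow> p (f y) = p (h y)"
    and ph: "continuous_map X (base \<xi>) (\<lambda>y. p (h y))"
    and a: "a \<in> topspace X" and e: "e > 0"
    and nc: "near_cont \<xi> X (\<lambda>_. e) f a"
    and close: "\<forall>\<^sub>F y in nhdsin X a. fdist \<xi> (h y) (f y) \<le> e"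
  shows "near_cont \<xi> X (\<lambda>_. 4 * e) h a"
  unfolding near_cont_def
proof (intro allI impI)
  fix S assume S: "is_open S \<and> h a \<in> S"
  define z where "z = fadd \<xi> (h a) (fscale \<xi> (-1) (f a))"
  have fa: "f a \<in> E" "h a \<in> E" "p (f a) = p (h a)" using f h pf a by auto
  have z: "z \<in> E" "p z = p (h a)" "fadd \<xi> (f a) z = h a"
    using fa by (auto simp: z_def E_p add_diff)
  have "fnorm \<xi> z \<le> e"
    using close a unfolding eventually_nhdsin by (auto simp: z_def fdist_def)
  obtain A B where AB: "is_open A" "f a \<in> A" "is_open B" "z \<in> B"
    "\<forall>a\<in>A. \<forall>b\<in>B. p a = p b \<longrightarrow> fadd \<xi> a b \<in> S"
    using add_nbhd[of S "f a" z] fa z S by auto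
  define C where "C = B \<inter> {x \<in> E. fnorm \<xi> x < 2 * e}"
  have C: "is_open C" "z \<in> C"
    using AB z e norm_usc \<open>fnorm \<xi> z \<le> e\<close> by (auto simp: C_def)
  have "openin (base \<xi>) (p ` C)" "p (h a) \<in> p ` C"
    using proj_open C imageI[OF C(2), of p] z(2) by (simp_all add: open_map_def)
  then have ev: "\<forall>\<^sub>F y in nhdsin X a. p (h y) \<in> p ` C"
    using eventually_nhdsin_continuous[OF ph _ a] by blast
  have "\<forall>\<^sub>F y in nhdsin X a. \<exists>x\<in>A. p x = p (f y) \<and> fdist \<xi> (f y) x \<le> e"
    using nc AB(1,2) by (auto simp: near_cont_def)
  with ev close eventually_nhdsin_topspace
  show "\<forall>\<^sub>F y in nhdsin X a. \<exists>x\<in>S. p x = p (h y) \<and> fdist \<xi> (h y) x \<le> 4 * e"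
  proof eventually_elim
    case (elim y)
    then obtain x w where x: "x \<in> A" "p x = p (f y)" "fdist \<xi> (f y) x \<le> e"
      and w: "w \<in> C" "p w = p (h y)" by auto
    have E: "x \<in> E" "w \<in> E" "f y \<in> E" "h y \<in> E" "p (f y) = p (h y)"
      using open_E[OF AB(1) x(1)] open_E[OF C(1) w(1)] f h pf elim by simp_all
    have xw: "fadd \<xi> x w \<in> S" "fadd \<xi> x w \<in> E" "p (fadd \<xi> x w) = p (h y)"
      using AB(5) x w E by (auto simp: C_def E_p)
    have "fdist \<xi> (h y) (fadd \<xi> x w) \<le> fdist \<xi> (h y) (f y) + (fdist \<xi> (f y) x + fdist \<xi> x (fadd \<xi> x w))"
      using fdist_triangle[of "h y" "f y" "fadd \<xi> x w"] fdist_triangle[of "f y" x "fadd \<xi> x w"] x E xw by simp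
    moreover have "fdist \<xi> x (fadd \<xi> x w) < 2 * e"
      using fdist_add_self[of x w] fdist_commute[of x "fadd \<xi> x w"] x w E xw by (simp add: C_def)
    ultimately have "fdist \<xi> (h y) (fadd \<xi> x w) \<le> 4 * e"
      using x elim by linarith
    with xw show ?case by blast
  qed
qed

lemma near_cont_add:
  assumes f: "\<And>y. y \<in> topspace X \<Longrightarrow> f y \<in> E" and h: "\<And>y. y \<in> topspace X \<Longrightarrow> h y \<in> E"
    and pf: "\<And>y. y \<in> topspace X \<Longrightarrow> p (f y) = p (h y)"
    and a: "a \<in> topspace X"
    and nf: "near_cont \<xi> X d f a" and nh: "near_cont \<xi> X e h a"
  shows "near_cont \<xi> X (\<lambda>y. d y + e y) (\<lambda>y. fadd \<xi> (f y) (h y)) a"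
  unfolding near_cont_def
proof (intro allI impI)
  fix S assume S: "is_open S \<and> fadd \<xi> (f a) (h a) \<in> S"
  then obtain A B where AB: "is_open A" "f a \<in> A" "is_open B" "h a \<in> B"
    "\<forall>a\<in>A. \<forall>b\<in>B. p a = p b \<longrightarrow> fadd \<xi> a b \<in> S"
    using add_nbhd[of S "f a" "h a"] f h pf a by auto
  have "\<forall>\<^sub>F y in nhdsin X a. \<exists>x\<in>A. p x = p (f y) \<and> fdist \<xi> (f y) x \<le> d y"
    "\<forall>\<^sub>F y in nhdsin X a. \<exists>x\<in>B. p x = p (h y) \<and> fdist \<xi> (h y) x \<le> e y"
    using nf nh AB by (auto simp: near_cont_def)
  with eventually_nhdsin_topspace
  show "\<forall>\<^sub>F y in nhdsin X a. \<exists>x\<in>S. p x = p (fadd \<xi> (f y) (h y)) \<and> fdist \<xi> (fadd \<xi> (f y) (h y)) x \<le> d y + e y"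
  proof eventually_elim
    case (elim y)
    then obtain x w where x: "x \<in> A" "p x = p (f y)" "fdist \<xi> (f y) x \<le> d y"
      and w: "w \<in> B" "p w = p (h y)" "fdist \<xi> (h y) w \<le> e y" by auto
    have E: "x \<in> E" "w \<in> E" "f y \<in> E" "h y \<in> E" "p (f y) = p (h y)"
      using open_E[OF AB(1) x(1)] open_E[OF AB(3) w(1)] f h pf elim by simp_all
    show ?case
      using fdist_add[of "f y" "h y" x w] x w E AB(5)
      by (intro bexI[of _ "fadd \<xi> x w"]) (auto simp: E_p)
  qed
qed

lemma near_cont_scale:
  assumes h: "\<And>y. y \<in> topspace X \<Longrightarrow> h y \<in> E"
    and r: "continuous_map X euclideanreal r" "\<And>y. y \<in> topspace X \<Longrightarrow> 0 \<le> r y"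
    and a: "a \<in> topspace X"
    and nh: "near_cont \<xi> X e h a"
  shows "near_cont \<xi> X (\<lambda>y. r y * e y) (\<lambda>y. fscale \<xi> (of_real (r y)) (h y)) a"
  unfolding near_cont_def
proof (intro allI impI)
  fix S assume S: "is_open S \<and> fscale \<xi> (of_real (r a)) (h a) \<in> S"
  then obtain d A where A: "0 < d" "is_open A" "h a \<in> A"
    "\<forall>k\<in>K. \<forall>x\<in>A. dist k (of_real (r a)) < d \<longrightarrow> fscale \<xi> k x \<in> S"
    using scale_nbhd[of S "h a" "of_real (r a)"] h a by auto
  have ev: "\<forall>\<^sub>F y in nhdsin X a. r y \<in> ball (r a) d"
    by (rule eventually_nhdsin_continuous[OF r(1) _ a]) (use A in auto)
  have "\<forall>\<^sub>F y in nhdsin X a. \<exists>x\<in>A. p x = p (h y) \<and> fdist \<xi> (h y) x \<le> e y"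
    using nh A by (auto simp: near_cont_def)
  with eventually_nhdsin_topspace ev
  show "\<forall>\<^sub>F y in nhdsin X a. \<exists>x\<in>S. p x = p (fscale \<xi> (of_real (r y)) (h y)) \<and>
     fdist \<xi> (fscale \<xi> (of_real (r y)) (h y)) x \<le> r y * e y"
  proof eventually_elim
    case (elim y)
    then obtain x where x: "x \<in> A" "p x = p (h y)" "fdist \<xi> (h y) x \<le> e y" by blast
    have E: "x \<in> E" "h y \<in> E" using open_E[OF A(2) x(1)] h elim by simp_all
    have "dist (complex_of_real (r y)) (of_real (r a)) < d"
      using elim(2) by (simp add: dist_commute dist_of_real del: of_real_diff)
    then have "fscale \<xi> (of_real (r y)) x \<in> S" using A(4) x K_simps(1) by blast
    then show ?case
      using fdist_scale[of "of_real (r y)" "h y" x] x E r(2)[OF elim(1)]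
      by (intro bexI[of _ "fscale \<xi> (of_real (r y)) x"]) (auto simp: E_p mult_left_mono)
  qed
qed

lemma continuous_zero_section:
  assumes q: "continuous_map X (base \<xi>) q"
  shows "continuous_map X (bspace \<xi>) (\<lambda>y. fzero \<xi> (q y))"
proof (rule continuous_map_if_eventually)
  have qb: "q y \<in> topspace (base \<xi>)" if "y \<in> topspace X" for y
    using q that by (auto simp: continuous_map_def)
  show "fzero \<xi> (q y) \<in> E" if "y \<in> topspace X" for y
    using qb that by (simp add: zero_E)
  fix a S assume a: "a \<in> topspace X" and S: "is_open S" "fzero \<xi> (q a) \<in> S"
  obtain U e where U: "openin (base \<xi>) U" "q a \<in> U" "e > 0" 
    "\<forall>z\<in>E. p z \<in> U \<longrightarrow> fnorm \<xi> z < e \<longrightarrow> z \<in> S"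
    using zero_nbhd[OF S(1) qb[OF a] S(2)] by blast
  show "\<forall>\<^sub>F y in nhdsin X a. fzero \<xi> (q y) \<in> S"
    using eventually_nhdsin_continuous[OF q U(1) a U(2)] eventually_nhdsin_topspace
    by eventually_elim (use U qb in \<open>auto simp: E_p norm_zero\<close>)
qed

section \<open>Finite sums in varying fibers\<close>

abbreviation bsum :: "'b \<Rightarrow> ('i \<Rightarrow> 'a) \<Rightarrow> 'i set \<Rightarrow> 'a" where
  "bsum t \<equiv> normed_fiber.fsum (fiber \<xi> t) (fadd \<xi>) (fzero \<xi> t)"

lemma bsum_closed:
  assumes "t \<in> topspace (base \<xi>)" "\<And>i. i \<in> I \<Longrightarrow> g i \<in> E \<and> p (g i) = t"
  shows "bsum t g I \<in> E" "p (bsum t g I) = t"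
  using normed_fiber.fsum_closed[OF normed_fiber[OF assms(1)], of I g] assms(2) by (auto simp: fiber_def)

lemma bsum_insert:
  assumes "t \<in> topspace (base \<xi>)" "finite I" "i \<notin> I" "\<And>j. j \<in> insert i I \<Longrightarrow> g j \<in> E \<and> p (g j) = t"
  shows "bsum t g (insert i I) = fadd \<xi> (g i) (bsum t g I)"
  using normed_fiber.fsum_insert[OF normed_fiber[OF assms(1)], of I i g] assms(2-) by (simp add: fiber_def)

lemma bsum_empty: "t \<in> topspace (base \<xi>) \<Longrightarrow> bsum t g {} = fzero \<xi> t"
  using normed_fiber.fsum_empty[OF normed_fiber] by blast

lemma near_cont_bsum:
  assumes q: "continuous_map X (base \<xi>) q" and a: "a \<in> topspace X"
    and "finite I"
    and "\<And>i y. i \<in> I \<Longrightarrow> y \<in> topspace X \<Longrightarrow> g i y \<in> E \<and> p (g i y) = q y"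
    and "\<And>i. i \<in> I \<Longrightarrow> near_cont \<xi> X (e i) (g i) a"
  shows "near_cont \<xi> X (\<lambda>y. \<Sum>i\<in>I. e i y) (\<lambda>y. bsum (q y) (\<lambda>i. g i y) I) a"
  using assms(3-)
proof (induction I rule: finite_induct)
  have qb: "q y \<in> topspace (base \<xi>)" if "y \<in> topspace X" for y
    using q that by (auto simp: continuous_map_def)
  have cong: "near_cont \<xi> X d h a" if "near_cont \<xi> X d f a" "\<And>y. y \<in> topspace X \<Longrightarrow> f y = h y" for d f h
    using eventually_nhdsin_topspace by (rule near_cont_mono[OF that(1) a eventually_mono]) (simp add: that(2))
  {
    case empty
    show ?case
      unfolding sum.empty
      by (rule cong[OF near_cont_continuous[OF continuous_zero_section[OF q] a]]) (simp_all add: qb bsum_empty)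
  next
    case (insert i I)
    have "near_cont \<xi> X (\<lambda>y. e i y + (\<Sum>i\<in>I. e i y)) (\<lambda>y. fadd \<xi> (g i y) (bsum (q y) (\<lambda>i. g i y) I)) a"
      by (rule near_cont_add) (use insert a in \<open>auto simp: bsum_closed qb\<close>)
    then show ?case
      unfolding sum.insert[OF insert.hyps]
      by (rule cong) (subst bsum_insert, use insert qb in auto)
  }
qed

end

section \<open>Lifting and patching\<close>


locale bundle_lifting =
  b1: scalar_bundle K \<xi>1 + b2: scalar_bundle K \<xi>2
  for K and \<xi>1 :: "('e, 'b) bundle_data" and \<xi>2 :: "('f, 'b) bundle_data" +
  fixes \<phi> :: "'e \<Rightarrow> 'f" and m :: real
  assumes base_eq: "base \<xi>1 = base \<xi>2"
    and bundle_map: "banach_bundle_map K \<xi>1 \<xi>2 \<phi>"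
    and norm_cont: "continuous_map (bspace \<xi>2) euclideanreal (fnorm \<xi>2)"
    and paracompact: "paracompact_space (bspace \<xi>2)"
    and m_pos: "m > 0"
    and bounded_lift: "\<And>y. y \<in> topspace (bspace \<xi>2) \<Longrightarrow>
      \<exists>x\<in>topspace (bspace \<xi>1). \<phi> x = y \<and> fnorm \<xi>1 x \<le> m * fnorm \<xi>2 y"
begin

abbreviation "X \<equiv> bspace \<xi>2"
abbreviation "E1 \<equiv> topspace (bspace \<xi>1)"
abbreviation "E2 \<equiv> topspace (bspace \<xi>2)"
abbreviation "p1 \<equiv> proj \<xi>1"
abbreviation "p2 \<equiv> proj \<xi>2"

lemma phi_continuous: "continuous_map (bspace \<xi>1) X \<phi>"
  using bundle_map by (simp add: banach_bundle_map_def)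

lemma phi_E: "x \<in> E1 \<Longrightarrow> \<phi> x \<in> E2"
  using continuous_map_image_subset_topspace[OF phi_continuous] by blast

lemma phi_p: "x \<in> E1 \<Longrightarrow> p2 (\<phi> x) = p1 x"
  using bundle_map b1.p_base[of x] unfolding banach_bundle_map_def fiber_def by blast

lemma phi_add: "\<lbrakk>x \<in> E1; y \<in> E1; p1 x = p1 y\<rbrakk> \<Longrightarrow> \<phi> (fadd \<xi>1 x y) = fadd \<xi>2 (\<phi> x) (\<phi> y)"
  using bundle_map b1.p_base[of x] by (simp add: banach_bundle_map_def fiber_def)

lemma phi_scale: "\<lbrakk>c \<in> K; x \<in> E1\<rbrakk> \<Longrightarrow> \<phi> (fscale \<xi>1 c x) = fscale \<xi>2 c (\<phi> x)"
  using bundle_map b1.p_base[of x] by (simp add: banach_bundle_map_def fiber_def)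

lemma base2: "y \<in> E2 \<Longrightarrow> p2 y \<in> topspace (base \<xi>1)"
  using b2.p_base base_eq by simp

lemma p2_continuous: "continuous_map X (base \<xi>1) p2"
  using b2.proj_continuous base_eq by simp

lemma phi_zero: "t \<in> topspace (base \<xi>1) \<Longrightarrow> \<phi> (fzero \<xi>1 t) = fzero \<xi>2 t"
  using phi_scale[of 0 "fzero \<xi>1 t"] b1.scale_zero[of 0 t] b2.scale_0[of "\<phi> (fzero \<xi>1 t)"]
  by (simp add: b1.E_p phi_E phi_p)

text \<open>For y near \<open>\<phi> x\<close>, openness of the projection provides a point a near x
  over the base point of y, with \<open>\<phi> a\<close> within e / m of y. The difference y -
  \<open>\<phi> a\<close> has a lift of norm < e, and adding it to a stays in S by the choice of the
  tube.\<close>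

lemma phi_open:
  assumes S: "b1.is_open S" and xS: "x \<in> S"
  shows "\<exists>W. openin X W \<and> \<phi> x \<in> W \<and> (\<forall>y\<in>W. \<exists>x\<in>S. \<phi> x = y)"
proof -
  have x: "x \<in> E1" using b1.open_E[OF S xS] .
  obtain A e where A: "b1.is_open A" "x \<in> A" "A \<subseteq> S" "e > 0"
    "\<forall>a\<in>A. \<forall>y\<in>E1. p1 y = p1 a \<longrightarrow> fdist \<xi>1 y a < e \<longrightarrow> y \<in> S"
    using b1.tube_nbhd[OF S xS] by blast
  have "0 < e / m" using A(4) m_pos by simp
  then obtain V where V: "openin X V" "\<phi> x \<in> V" "\<forall>a\<in>V. \<forall>b\<in>V. p2 a = p2 b \<longrightarrow> fdist \<xi>2 a b < e / m"
    using b2.thin_nbhd[OF phi_E[OF x]] by blast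
  define C where "C = A \<inter> {x \<in> E1. \<phi> x \<in> V}"
  have C: "b1.is_open C" "x \<in> C"
    unfolding C_def using A V x by (auto intro!: openin_Int openin_continuous_map_preimage[OF phi_continuous])
  then have pC: "openin (base \<xi>2) (p1 ` C)"
    using b1.proj_open base_eq by (simp add: open_map_def)
  define W where "W = V \<inter> {y \<in> E2. p2 y \<in> p1 ` C}"
  have "openin X W"
    unfolding W_def by (intro openin_Int V openin_continuous_map_preimage[OF b2.proj_continuous pC])
  moreover have "\<phi> x \<in> W"
    unfolding W_def using V C x by (simp add: phi_E phi_p)
  moreover have "\<exists>x\<in>S. \<phi> x = y" if y: "y \<in> W" for y
  proof -
    obtain a where a: "a \<in> C" "p1 a = p2 y" and yV: "y \<in> V" "y \<in> E2"
      using y by (auto simp: W_def)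
    have a': "a \<in> A" "a \<in> E1" "\<phi> a \<in> V" using a by (auto simp: C_def)
    define w where "w = fadd \<xi>2 y (fscale \<xi>2 (-1) (\<phi> a))"
    have w: "w \<in> E2" "p2 w = p2 y" using yV a a' by (simp_all add: w_def b2.E_p phi_E phi_p)
    have "fnorm \<xi>2 w < e / m"
      using V(3) yV a a' by (simp add: w_def phi_p flip: fdist_def)
    moreover obtain z where z: "z \<in> E1" "\<phi> z = w" "fnorm \<xi>1 z \<le> m * fnorm \<xi>2 w"
      using bounded_lift[OF w(1)] by blast
    ultimately have "fnorm \<xi>1 z < e"
      using m_pos by (simp add: field_simps)
    have pz: "p1 z = p1 a" using phi_p[OF z(1)] z w a by simp
    have "fadd \<xi>1 a z \<in> S"
      using A(5)[rule_format, OF a'(1), of "fadd \<xi>1 a z"] \<open>fnorm \<xi>1 z < e\<close> a' z pz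
      by (simp add: b1.E_p b1.fdist_add_self)
    moreover have "\<phi> (fadd \<xi>1 a z) = y"
      using a a' z pz yV by (simp add: phi_add w_def b2.add_diff phi_E phi_p)
    ultimately show ?thesis by blast
  qed
  ultimately show ?thesis by blast
qed

lemma convex_combination:
  assumes y: "y \<in> E2" and c: "c \<in> E1" "p1 c = p2 y"
    and "finite I" "\<And>i. i \<in> I \<Longrightarrow> g i \<in> E1 \<and> \<phi> (g i) = y \<and> fdist \<xi>1 (g i) c \<le> r \<and> 0 \<le> w i"
  defines "b \<equiv> b1.bsum (p2 y) (\<lambda>i. fscale \<xi>1 (of_real (w i)) (g i)) I"
  shows "\<phi> b = fscale \<xi>2 (of_real (sum w I)) y"
    and "fdist \<xi>1 b (fscale \<xi>1 (of_real (sum w I)) c) \<le> sum w I * r"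
proof -
  have "\<phi> (b1.bsum (p2 y) (\<lambda>i. fscale \<xi>1 (of_real (w i)) (g i)) I) = fscale \<xi>2 (of_real (sum w I)) y \<and>
    fdist \<xi>1 (b1.bsum (p2 y) (\<lambda>i. fscale \<xi>1 (of_real (w i)) (g i)) I) (fscale \<xi>1 (of_real (sum w I)) c) \<le> sum w I * r"
    using assms(4,5)
  proof (induction I rule: finite_induct)
    case empty
    show ?case
      using y c b1.fdist_self[of "fzero \<xi>1 (p2 y)"]
      by (simp add: b1.bsum_empty base2 phi_zero b2.scale_0 b1.scale_0 b1.E_p)
  next
    case (insert i I)
    let ?g = "\<lambda>i. fscale \<xi>1 (of_real (w i)) (g i)"
    let ?b = "b1.bsum (p2 y) ?g I"
    have g: "g j \<in> E1" "p1 (g j) = p2 y" "?g j \<in> E1" "p1 (?g j) = p2 y" if "j \<in> insert i I" for j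
      using insert.prems[OF that] phi_p[of "g j"] by (auto simp: b1.E_p)
    have gi: "g i \<in> E1" "p1 (g i) = p2 y" "?g i \<in> E1" "p1 (?g i) = p2 y"
      "\<phi> (g i) = y" "fdist \<xi>1 (g i) c \<le> r" "0 \<le> w i"
      using g[of i] insert.prems[of i] by auto
    have IH: "\<phi> ?b = fscale \<xi>2 (of_real (sum w I)) y"
      "fdist \<xi>1 ?b (fscale \<xi>1 (of_real (sum w I)) c) \<le> sum w I * r"
      using insert.IH insert.prems by auto
    have b: "?b \<in> E1" "p1 ?b = p2 y"
      using b1.bsum_closed[OF base2[OF y], of I ?g] g by auto
    have ins: "b1.bsum (p2 y) ?g (insert i I) = fadd \<xi>1 (?g i) ?b"
      by (rule b1.bsum_insert[OF base2[OF y] insert.hyps]) (use g in auto)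
    have sc: "sum w (insert i I) = w i + sum w I"
      using insert.hyps by simp
    have "\<phi> (fadd \<xi>1 (?g i) ?b) = fscale \<xi>2 (of_real (w i + sum w I)) y"
      using gi b IH y b2.add_scale[of "of_real (w i)" "of_real (sum w I)" y]
      by (simp add: phi_add phi_scale del: of_real_sum)
    moreover have "fdist \<xi>1 (fadd \<xi>1 (?g i) ?b) (fadd \<xi>1 (fscale \<xi>1 (of_real (w i)) c) (fscale \<xi>1 (of_real (sum w I)) c))
       \<le> w i * r + sum w I * r"
    proof -
      have "fdist \<xi>1 (?g i) (fscale \<xi>1 (of_real (w i)) c) \<le> w i * r"
        using gi c by (simp add: b1.fdist_scale mult_left_mono)
      then show ?thesis
        using b1.fdist_add[of "?g i" ?b "fscale \<xi>1 (of_real (w i)) c" "fscale \<xi>1 (of_real (sum w I)) c"] gi b c IH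
        by (simp add: b1.E_p del: of_real_sum)
    qed
    moreover have "fadd \<xi>1 (fscale \<xi>1 (of_real (w i)) c) (fscale \<xi>1 (of_real (sum w I)) c) =
       fscale \<xi>1 (of_real (w i + sum w I)) c"
      using c b1.add_scale[of "of_real (w i)" "of_real (sum w I)" c] by (simp del: of_real_sum)
    ultimately show ?case
      unfolding ins sc by (simp add: distrib_right)
  qed
  then show "\<phi> b = fscale \<xi>2 (of_real (sum w I)) y"
    and "fdist \<xi>1 b (fscale \<xi>1 (of_real (sum w I)) c) \<le> sum w I * r"
    by (simp_all add: b_def)
qed

text \<open>Nothing is assumed about how g chooses its values. For a neighbourhood T of
  \<open>g a\<close>, the open set \<open>T \<inter> S\<close> meets every nearby fiber, and a point
  found there is within e of \<open>g y\<close> because both lie in the thin set S.\<close>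

lemma near_cont_thin:
  assumes V: "openin X V" "a \<in> V" and S: "b1.is_open S"
    and thin: "\<forall>x\<in>S. \<forall>x'\<in>S. p1 x = p1 x' \<longrightarrow> fdist \<xi>1 x x' < e"
    and g: "\<And>y. y \<in> V \<Longrightarrow> g y \<in> S \<and> p1 (g y) = p2 y"
  shows "near_cont \<xi>1 X (\<lambda>_. e) g a"
  unfolding near_cont_def
proof (intro allI impI)
  fix T assume T: "b1.is_open T \<and> g a \<in> T"
  then have TS: "b1.is_open (T \<inter> S)" "g a \<in> T \<inter> S"
    using S g V by auto
  have "openin (base \<xi>1) (p1 ` (T \<inter> S))" "p2 a \<in> p1 ` (T \<inter> S)"
    using b1.proj_open TS(1) imageI[OF TS(2), of p1] g[OF V(2)] by (simp_all add: open_map_def)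
  moreover have "a \<in> topspace X" using V openin_subset by blast
  ultimately have "\<forall>\<^sub>F y in nhdsin X a. p2 y \<in> p1 ` (T \<inter> S)"
    using eventually_nhdsin_continuous[OF p2_continuous] by blast
  with eventually_nhdsin_open[OF V]
  show "\<forall>\<^sub>F y in nhdsin X a. \<exists>x\<in>T. p1 x = p1 (g y) \<and> fdist \<xi>1 (g y) x \<le> e"
  proof eventually_elim
    case (elim y)
    then obtain x where "x \<in> T" "x \<in> S" "p1 x = p2 y" by auto
    with thin g[OF elim(1)] show ?case by (intro bexI[of _ x]) (auto intro: less_imp_le)
  qed
qed

text \<open>The reference map c and the radius r need not be continuous: the estimate of the
  distance to \<open>c y\<close> is a convexity statement in a single fiber. The weighted local
  choices have errors \<open>w V y * e\<close>, which add up to e.\<close>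

lemma patching:
  assumes c: "\<And>y. y \<in> E2 \<Longrightarrow> c y \<in> E1 \<and> p1 (c y) = p2 y"
    and local: "\<And>a. a \<in> E2 \<Longrightarrow> \<exists>W S. openin X W \<and> a \<in> W \<and> b1.is_open S \<and>
      (\<forall>x\<in>S. \<forall>x'\<in>S. p1 x = p1 x' \<longrightarrow> fdist \<xi>1 x x' < e) \<and>
      (\<forall>y\<in>W. \<exists>x\<in>S. \<phi> x = y \<and> fdist \<xi>1 x (c y) \<le> r y)"
  shows "\<exists>f. \<forall>y\<in>E2. f y \<in> E1 \<and> \<phi> (f y) = y \<and> fdist \<xi>1 (f y) (c y) \<le> r y \<and> near_cont \<xi>1 X (\<lambda>_. e) f y"
proof -
  define good where "good W S \<longleftrightarrow> b1.is_open S \<and>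
      (\<forall>x\<in>S. \<forall>x'\<in>S. p1 x = p1 x' \<longrightarrow> fdist \<xi>1 x x' < e) \<and>
      (\<forall>y\<in>W. \<exists>x\<in>S. \<phi> x = y \<and> fdist \<xi>1 x (c y) \<le> r y)" for W S
  define \<U> where "\<U> = {W. openin X W \<and> (\<exists>S. good W S)}"
  have opU: "\<And>U. U \<in> \<U> \<Longrightarrow> openin X U" by (simp add: \<U>_def)
  have covU: "\<Union>\<U> = topspace X"
  proof
    show "\<Union>\<U> \<subseteq> topspace X" using opU openin_subset by blast
    show "topspace X \<subseteq> \<Union>\<U>"
    proof
      fix a assume "a \<in> topspace X"
      from local[OF this] obtain W S where "openin X W" "a \<in> W" "good W S"
        unfolding good_def by (elim exE conjE) simp
      then show "a \<in> \<Union>\<U>" by (auto simp: \<U>_def)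
    qed
  qed
  obtain \<V> w where opV: "\<And>V. V \<in> \<V> \<Longrightarrow> openin X V" and ref: "\<And>V. V \<in> \<V> \<Longrightarrow> \<exists>U\<in>\<U>. V \<subseteq> U"
    and lf: "locally_finite_in X \<V>"
    and wc: "\<And>V. V \<in> \<V> \<Longrightarrow> continuous_map X euclideanreal (w V)"
    and w0: "\<And>V x. V \<in> \<V> \<Longrightarrow> x \<in> topspace X \<Longrightarrow> 0 \<le> w V x"
    and wC: "\<And>V. V \<in> \<V> \<Longrightarrow> \<exists>C. closedin X C \<and> C \<subseteq> V \<and> (\<forall>x \<in> topspace X - C. w V x = 0)"
    and w1: "\<And>x. x \<in> topspace X \<Longrightarrow> finite {V \<in> \<V>. x \<in> V} \<and> (\<Sum>V | V \<in> \<V> \<and> x \<in> V. w V x) = (1::real)"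
    by (rule paracompact_partition_of_unity[OF paracompact _ covU], erule opU) (rule that; assumption)
  have "\<exists>S. good V S" if V: "V \<in> \<V>" for V
  proof -
    obtain U S where "V \<subseteq> U" "good U S"
      using ref[OF V] by (auto simp: \<U>_def)
    then have "good V S"
      unfolding good_def by (elim conjE) (intro conjI; blast)
    then show ?thesis ..
  qed
  then obtain S where S: "\<And>V. V \<in> \<V> \<Longrightarrow> good V (S V)" by metis
  define P where "P V y x \<longleftrightarrow> x \<in> S V \<and> \<phi> x = y \<and> fdist \<xi>1 x (c y) \<le> r y" for V y x
  \<comment> \<open>Off V the value is the zero vector of the right fiber, so sums over a larger
    index set still make sense there; the weight of V is zero at such points.\<close>
  define g where "g V y = (if y \<in> V then SOME x. P V y x else fzero \<xi>1 (p2 y))" for V y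
  have gP: "P V y (g V y)" if "V \<in> \<V>" "y \<in> V" for V y
  proof -
    have "\<exists>x. P V y x" using S[OF that(1)] that(2) by (auto simp: good_def P_def)
    then show ?thesis using that(2) by (simp add: g_def someI_ex)
  qed
  have gE: "g V y \<in> E1" "p1 (g V y) = p2 y" if "V \<in> \<V>" "y \<in> topspace X" for V y
  proof -
    have "g V y \<in> E1 \<and> p1 (g V y) = p2 y"
    proof (cases "y \<in> V")
      case True
      then have "g V y \<in> E1"
        using gP[OF that(1) True] S[OF that(1)] b1.open_E[of "S V"] by (auto simp: P_def good_def)
      then show ?thesis using gP[OF that(1) True] phi_p[of "g V y"] by (auto simp: P_def)
    next
      case False
      then show ?thesis using that base2 by (simp add: g_def b1.E_p)
    qed
    then show "g V y \<in> E1" "p1 (g V y) = p2 y" by auto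
  qed
  let ?h = "\<lambda>V y. fscale \<xi>1 (of_real (w V y)) (g V y)"
  have hE: "?h V y \<in> E1 \<and> p1 (?h V y) = p2 y" if "V \<in> \<V>" "y \<in> topspace X" for V y
    using gE[OF that] by (simp add: b1.E_p)
  define f where "f y = b1.bsum (p2 y) (\<lambda>V. ?h V y) {V \<in> \<V>. y \<in> V}" for y
  have nh: "near_cont \<xi>1 X (\<lambda>y. w V y * e) (?h V) a" if V: "V \<in> \<V>" and a: "a \<in> topspace X" for V a
  proof (cases "a \<in> V")
    case True
    have "near_cont \<xi>1 X (\<lambda>_. e) (g V) a"
      by (rule near_cont_thin[OF opV[OF V] True, of "S V"])
        (use S[OF V] gP[OF V] gE[OF V] openin_subset[OF opV[OF V]] in \<open>auto simp: good_def P_def\<close>)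
    then show ?thesis
      by (intro b1.near_cont_scale wc V a w0 gE)
  next
    case False
    \<comment> \<open>Outside V the weighted choice agrees with the continuous zero section on the
      complement of C, a whole neighbourhood of a.\<close>
    obtain C where C: "closedin X C" "C \<subseteq> V" "\<forall>x \<in> topspace X - C. w V x = 0"
      using wC[OF V] by blast
    have "\<forall>\<^sub>F y in nhdsin X a. y \<in> topspace X - C"
      by (rule eventually_nhdsin_open) (use C False a in auto)
    then show ?thesis
      by (intro b1.near_cont_mono[OF b1.near_cont_continuous[OF b1.continuous_zero_section[OF p2_continuous] a, of "\<lambda>_. 0"] a])
        (auto elim!: eventually_mono simp: C gE V b1.scale_0)
  qed
  have "near_cont \<xi>1 X (\<lambda>_. e) f a" if a: "a \<in> topspace X" for a
  proof -
    obtain N where N: "openin X N" "a \<in> N" "finite {V \<in> \<V>. V \<inter> N \<noteq> {}}"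
      using lf a unfolding locally_finite_in_def by blast
    \<comment> \<open>The sets containing y vary with y, whereas \<open>near_cont_bsum\<close> needs
      a fixed finite index set; on N the additional summands are zero.\<close>
    let ?I = "{V \<in> \<V>. V \<inter> N \<noteq> {}}"
    have "near_cont \<xi>1 X (\<lambda>y. \<Sum>V\<in>?I. w V y * e) (\<lambda>y. b1.bsum (p2 y) (\<lambda>V. ?h V y) ?I) a"
      by (rule b1.near_cont_bsum[OF p2_continuous a N(3)]) (use hE nh a in auto)
    then show ?thesis
    proof (rule b1.near_cont_mono[OF _ a])
      show "\<forall>\<^sub>F y in nhdsin X a. b1.bsum (p2 y) (\<lambda>V. ?h V y) ?I = f y \<and> (\<Sum>V\<in>?I. w V y * e) \<le> e"
        using eventually_nhdsin_open[OF N(1,2)]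
      proof eventually_elim
        case (elim y)
        have y: "y \<in> topspace X" using elim N(1) openin_subset by blast
        have wz: "w V y = 0" if "V \<in> ?I - {V \<in> \<V>. y \<in> V}" for V
          using wC[of V] that y by blast
        have sub: "{V \<in> \<V>. y \<in> V} \<subseteq> ?I" using elim by blast
        have "f y = b1.bsum (p2 y) (\<lambda>V. ?h V y) ?I"
          unfolding f_def
        proof (rule normed_fiber.fsum_mono_neutral[OF b1.normed_fiber[OF base2[OF y]] N(3) sub])
          show "?h V y = fzero \<xi>1 (p2 y)" if "V \<in> ?I - {V \<in> \<V>. y \<in> V}" for V
            using wz[OF that] that gE y by (simp add: b1.scale_0)
          show "?h V y \<in> fiber \<xi>1 (p2 y)" if "V \<in> ?I" for V
            using hE[of V y] that y by (simp add: fiber_def)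
        qed
        moreover have "(\<Sum>V | V \<in> \<V> \<and> y \<in> V. w V y) = (\<Sum>V\<in>?I. w V y)"
          by (rule sum.mono_neutral_left[OF N(3) sub]) (use wz in blast)
        ultimately show ?case
          using w1[OF y] by (simp flip: sum_distrib_right)
      qed
    qed
  qed
  moreover have "f y \<in> E1 \<and> \<phi> (f y) = y \<and> fdist \<xi>1 (f y) (c y) \<le> r y" if y: "y \<in> E2" for y
  proof (intro conjI)
    show "f y \<in> E1"
      unfolding f_def by (rule b1.bsum_closed[OF base2[OF y]]) (use hE y in auto)
    have ok: "\<And>V. V \<in> {V \<in> \<V>. y \<in> V} \<Longrightarrow> g V y \<in> E1 \<and> \<phi> (g V y) = y \<and> fdist \<xi>1 (g V y) (c y) \<le> r y \<and> 0 \<le> w V y"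
      using gP gE y w0 by (auto simp: P_def)
    have cy: "c y \<in> E1" "p1 (c y) = p2 y" and fin: "finite {V \<in> \<V>. y \<in> V}"
      using c[OF y] w1[OF y] by auto
    note conv = convex_combination[where g = "\<lambda>V. g V y" and w = "\<lambda>V. w V y", OF y cy fin]
    have "\<phi> (f y) = fscale \<xi>2 (of_real (\<Sum>V | V \<in> \<V> \<and> y \<in> V. w V y)) y"
      unfolding f_def by (rule conv(1)) (rule ok)
    moreover have "fdist \<xi>1 (f y) (fscale \<xi>1 (of_real (\<Sum>V | V \<in> \<V> \<and> y \<in> V. w V y)) (c y)) \<le>
        (\<Sum>V | V \<in> \<V> \<and> y \<in> V. w V y) * r y"
      unfolding f_def by (rule conv(2)) (rule ok)
    moreover have "(\<Sum>V | V \<in> \<V> \<and> y \<in> V. w V y) = 1" using w1[OF y] by simp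
    ultimately show "\<phi> (f y) = y" "fdist \<xi>1 (f y) (c y) \<le> r y"
      using y cy by (simp_all add: b2.scale_one b1.scale_one del: of_real_sum)
  qed
  ultimately show ?thesis by blast
qed

end

section \<open>A continuous lift\<close>


context bundle_lifting
begin

text \<open>By \<open>tube_nbhd\<close>, points of the fiber that are norm-close to h enter the open
  preimage of any neighbourhood of \<open>\<phi> h\<close>, so y cannot be separated from
  \<open>\<phi> h\<close> in the Hausdorff space E_2.\<close>

lemma phi_limit:
  assumes h: "h \<in> E1" and ex: "\<And>e. e > 0 \<Longrightarrow> \<exists>x\<in>E1. p1 x = p1 h \<and> fdist \<xi>1 x h < e \<and> \<phi> x = y"
  shows "\<phi> h = y"
proof (rule ccontr)
  assume ne: "\<phi> h \<noteq> y"
  have "y \<in> E2" using ex[of 1] phi_E by auto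
  moreover have "Hausdorff_space X" using paracompact by (simp add: paracompact_space_def)
  ultimately obtain U V where UV: "openin X U" "openin X V" "\<phi> h \<in> U" "y \<in> V" "disjnt U V"
    using ne phi_E[OF h] unfolding Hausdorff_space_def by blast
  have "b1.is_open {x \<in> E1. \<phi> x \<in> U}" "h \<in> {x \<in> E1. \<phi> x \<in> U}"
    using openin_continuous_map_preimage[OF phi_continuous UV(1)] h UV by auto
  from b1.tube_nbhd[OF this] obtain A e where A: "h \<in> A" "e > 0"
    "\<forall>a\<in>A. \<forall>y\<in>E1. p1 y = p1 a \<longrightarrow> fdist \<xi>1 y a < e \<longrightarrow> y \<in> {x \<in> E1. \<phi> x \<in> U}"
    by blast
  obtain x where "x \<in> E1" "p1 x = p1 h" "fdist \<xi>1 x h < e" "\<phi> x = y"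
    using ex[OF A(2)] by blast
  with A UV show False by (auto simp: disjnt_iff)
qed

definition near_lift :: "real \<Rightarrow> ('f \<Rightarrow> 'e) \<Rightarrow> bool" where
  "near_lift e f \<longleftrightarrow> (\<forall>y\<in>E2. f y \<in> E1 \<and> \<phi> (f y) = y \<and> near_cont \<xi>1 X (\<lambda>_. e) f y)"

lemma near_lift_p: "near_lift e f \<Longrightarrow> y \<in> E2 \<Longrightarrow> p1 (f y) = p2 y"
  unfolding near_lift_def using phi_p by metis

lemma initial_lift: "\<exists>f. near_lift 1 f \<and> (\<forall>y\<in>E2. fnorm \<xi>1 (f y) \<le> m * fnorm \<xi>2 y + (m + 1))"
proof -
  \<comment> \<open>Near a, lifts can be taken with norm below m |a| + 1, and |a| \<le> |y| + 1 by
    continuity of the norm of \<open>\<xi>2\<close>; together this gives m |y| + m + 1.\<close>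
  let ?r = "\<lambda>y. m * fnorm \<xi>2 y + (m + 1)"
  have "\<exists>f. \<forall>y\<in>E2. f y \<in> E1 \<and> \<phi> (f y) = y \<and> fdist \<xi>1 (f y) (fzero \<xi>1 (p2 y)) \<le> ?r y \<and> near_cont \<xi>1 X (\<lambda>_. 1) f y"
  proof (rule patching)
    show "fzero \<xi>1 (p2 y) \<in> E1 \<and> p1 (fzero \<xi>1 (p2 y)) = p2 y" if "y \<in> E2" for y
      using base2[OF that] by (simp add: b1.E_p)
    fix a assume a: "a \<in> E2"
    obtain x where x: "x \<in> E1" "\<phi> x = a" "fnorm \<xi>1 x \<le> m * fnorm \<xi>2 a"
      using bounded_lift[OF a] by blast
    obtain A where A: "b1.is_open A" "x \<in> A" "\<forall>x\<in>A. \<forall>x'\<in>A. p1 x = p1 x' \<longrightarrow> fdist \<xi>1 x x' < 1"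
      using b1.thin_nbhd[OF x(1), of 1] by auto
    define S where "S = A \<inter> {x \<in> E1. fnorm \<xi>1 x < m * fnorm \<xi>2 a + 1}"
    have S: "b1.is_open S" "x \<in> S"
      using A x b1.norm_usc by (auto simp: S_def)
    obtain V where V: "openin X V" "a \<in> V" "\<forall>y\<in>V. \<exists>x\<in>S. \<phi> x = y"
      using phi_open[OF S] x(2) by blast
    define W where "W = V \<inter> {y \<in> E2. fnorm \<xi>2 y \<in> {fnorm \<xi>2 a - 1<..}}"
    have W: "openin X W"
      unfolding W_def by (rule openin_Int[OF V(1) openin_continuous_map_preimage[OF norm_cont]]) simp
    have aW: "a \<in> W" using V a by (simp add: W_def)
    have thin: "\<forall>x\<in>S. \<forall>x'\<in>S. p1 x = p1 x' \<longrightarrow> fdist \<xi>1 x x' < 1"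
      using A(3) by (auto simp: S_def)
    have "\<exists>x\<in>S. \<phi> x = y \<and> fdist \<xi>1 x (fzero \<xi>1 (p2 y)) \<le> ?r y" if y: "y \<in> W" for y
    proof -
      obtain x' where x': "x' \<in> S" "\<phi> x' = y" using V(3) y by (auto simp: W_def)
      have "x' \<in> E1" "p1 x' = p2 y" "fnorm \<xi>1 x' < m * fnorm \<xi>2 a + 1" "fnorm \<xi>2 a \<le> fnorm \<xi>2 y + 1"
        using x' y phi_p[of x'] by (auto simp: S_def W_def)
      moreover from this have "m * fnorm \<xi>2 a \<le> m * (fnorm \<xi>2 y + 1)"
        using m_pos by (intro mult_left_mono) auto
      ultimately show ?thesis
        using x' b1.fdist_zero[of x'] by (intro bexI[of _ x']) (auto simp: distrib_left)
    qed
    with S(1) W aW thin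
    show "\<exists>W S. openin X W \<and> a \<in> W \<and> b1.is_open S \<and> (\<forall>x\<in>S. \<forall>x'\<in>S. p1 x = p1 x' \<longrightarrow> fdist \<xi>1 x x' < 1) \<and>
      (\<forall>y\<in>W. \<exists>x\<in>S. \<phi> x = y \<and> fdist \<xi>1 x (fzero \<xi>1 (p2 y)) \<le> ?r y)"
      by blast
  qed
  then obtain f where f: "\<forall>y\<in>E2. f y \<in> E1 \<and> \<phi> (f y) = y \<and> fdist \<xi>1 (f y) (fzero \<xi>1 (p2 y)) \<le> ?r y \<and> near_cont \<xi>1 X (\<lambda>_. 1) f y"
    by blast
  then have nl: "near_lift 1 f" by (simp add: near_lift_def)
  moreover have "fnorm \<xi>1 (f y) \<le> ?r y" if "y \<in> E2" for y
    using f that b1.fdist_zero[of "f y"] near_lift_p[OF nl that] by auto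
  ultimately show ?thesis by blast
qed

text \<open>Take a set S of fiberwise diameter below e / 2 around \<open>f a\<close>. Near a,
  \<open>f y\<close> is within e of some point of S, and y has a lift in S by openness of
  \<open>\<phi>\<close>. That lift is within e + e / 2 of \<open>f y\<close>, hence within 2
  e.\<close>

lemma refine_lift:
  assumes f: "near_lift e f" and e: "e > 0"
  shows "\<exists>f'. near_lift (e / 2) f' \<and> (\<forall>y\<in>E2. fdist \<xi>1 (f' y) (f y) \<le> 2 * e)"
proof -
  have fE: "f y \<in> E1" "\<phi> (f y) = y" "p1 (f y) = p2 y" "near_cont \<xi>1 X (\<lambda>_. e) f y" if "y \<in> E2" for y
    using f that near_lift_p[OF f that] by (auto simp: near_lift_def)
  have "\<exists>f'. \<forall>y\<in>E2. f' y \<in> E1 \<and> \<phi> (f' y) = y \<and> fdist \<xi>1 (f' y) (f y) \<le> 2 * e \<and> near_cont \<xi>1 X (\<lambda>_. e / 2) f' y"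
  proof (rule patching)
    show "f y \<in> E1 \<and> p1 (f y) = p2 y" if "y \<in> E2" for y
      using fE[OF that] by blast
    fix a assume a: "a \<in> E2"
    obtain S where S: "b1.is_open S" "f a \<in> S" "\<forall>x\<in>S. \<forall>x'\<in>S. p1 x = p1 x' \<longrightarrow> fdist \<xi>1 x x' < e / 2"
      using b1.thin_nbhd[OF fE(1)[OF a], of "e / 2"] e by auto
    obtain V where V: "openin X V" "a \<in> V" "\<forall>y\<in>V. \<exists>x\<in>S. \<phi> x = y"
      using phi_open[OF S(1,2)] fE(2)[OF a] by auto
    obtain U where U: "openin X U" "a \<in> U" "\<forall>y\<in>U. \<exists>x\<in>S. p1 x = p1 (f y) \<and> fdist \<xi>1 (f y) x \<le> e"
      using fE(4)[OF a] S(1,2) a unfolding near_cont_def eventually_nhdsin by blast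
    have "\<exists>x\<in>S. \<phi> x = y \<and> fdist \<xi>1 x (f y) \<le> 2 * e" if y: "y \<in> U \<inter> V" for y
    proof -
      obtain x x' where x: "x \<in> S" "p1 x = p1 (f y)" "fdist \<xi>1 (f y) x \<le> e" and x': "x' \<in> S" "\<phi> x' = y"
        using U(3) V(3) y by blast
      have yE: "y \<in> E2" using y U(1) openin_subset by blast
      have E: "x \<in> E1" "x' \<in> E1" "p1 x' = p2 y"
        using b1.open_E[OF S(1)] x x' phi_p[of x'] by auto
      have "fdist \<xi>1 x' (f y) \<le> fdist \<xi>1 x' x + fdist \<xi>1 x (f y)"
        by (rule b1.fdist_triangle) (use E x fE[OF yE] in auto)
      moreover have "fdist \<xi>1 x' x < e / 2"
        using S(3) x x' E fE[OF yE] by auto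
      moreover have "fdist \<xi>1 x (f y) = fdist \<xi>1 (f y) x"
        by (rule b1.fdist_commute) (use E x fE[OF yE] in auto)
      ultimately have "fdist \<xi>1 x' (f y) \<le> 2 * e" using x(3) e by simp
      with x' show ?thesis by blast
    qed
    moreover have "openin X (U \<inter> V)" "a \<in> U \<inter> V" using U V by auto
    ultimately show "\<exists>W S. openin X W \<and> a \<in> W \<and> b1.is_open S \<and> (\<forall>x\<in>S. \<forall>x'\<in>S. p1 x = p1 x' \<longrightarrow> fdist \<xi>1 x x' < e / 2) \<and>
      (\<forall>y\<in>W. \<exists>x\<in>S. \<phi> x = y \<and> fdist \<xi>1 x (f y) \<le> 2 * e)"
      using S(1,3) by blast
  qed
  then show ?thesis unfolding near_lift_def by blast
qed

lemma continuous_lift: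
  "\<exists>f. continuous_map X (bspace \<xi>1) f \<and> (\<forall>y\<in>E2. \<phi> (f y) = y \<and> fnorm \<xi>1 (f y) \<le> m * fnorm \<xi>2 y + (m + 5))"
proof -
  \<comment> \<open>The norm bound is recorded for the first map only; the limit obtains it from its
    distance to that map.\<close>
  define good where "good n f \<longleftrightarrow> near_lift (1 / 2 ^ n) f \<and>
      (n = 0 \<longrightarrow> (\<forall>y\<in>E2. fnorm \<xi>1 (f y) \<le> m * fnorm \<xi>2 y + (m + 1)))" for n :: nat and f
  have "\<exists>F. \<forall>n. good n (F n) \<and> (\<forall>y\<in>E2. fdist \<xi>1 (F (Suc n) y) (F n y) \<le> 2 / 2 ^ n)"
  proof (rule dependent_nat_choice)
    show "\<exists>f. good 0 f" using initial_lift by (simp add: good_def)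
    show "\<exists>f'. good (Suc n) f' \<and> (\<forall>y\<in>E2. fdist \<xi>1 (f' y) (f y) \<le> 2 / 2 ^ n)" if "good n f" for f n
      using refine_lift[of "1 / 2 ^ n" f] that by (auto simp: good_def mult.commute)
  qed
  then obtain F where F: "\<And>n. good n (F n)"
    and step: "\<And>n y. y \<in> E2 \<Longrightarrow> fdist \<xi>1 (F (Suc n) y) (F n y) \<le> 2 / 2 ^ n"
    by blast
  have nl: "near_lift (1 / 2 ^ n) (F n)" for n using F[of n] by (simp add: good_def)
  have FE: "F n y \<in> E1" "\<phi> (F n y) = y" "p1 (F n y) = p2 y" "near_cont \<xi>1 X (\<lambda>_. 1 / 2 ^ n) (F n) y" if "y \<in> E2" for n y
    using nl[of n] that near_lift_p[OF nl[of n] that] by (auto simp: near_lift_def)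
  \<comment> \<open>4 / 2^n is the sum of the tail of the steps 2 / 2^j with j \<ge> n. For n = 0 it
    turns the constant m + 1 of the first lift into m + 5.\<close>
  have dist: "fdist \<xi>1 (F (n + k) y) (F n y) \<le> 4 / 2 ^ n" if y: "y \<in> E2" for n k y
  proof (induction k arbitrary: n)
    case 0
    then show ?case using FE[OF y] by (simp add: b1.fdist_self)
  next
    case (Suc k)
    have "fdist \<xi>1 (F (n + Suc k) y) (F n y) \<le> fdist \<xi>1 (F (Suc n + k) y) (F (Suc n) y) + fdist \<xi>1 (F (Suc n) y) (F n y)"
      using FE[OF y] by (simp add: b1.fdist_triangle)
    also have "\<dots> \<le> 4 / 2 ^ Suc n + 2 / 2 ^ n"
      by (intro add_mono Suc.IH step y)
    also have "\<dots> = 4 / 2 ^ n" by (simp add: field_simps)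
    finally show ?case .
  qed
  have lim0: "(\<lambda>n. 4 / 2 ^ n :: real) \<longlonglongrightarrow> 0"
    using LIMSEQ_divide_realpow_zero[of 2 4] by simp
  have small: "\<exists>n. 4 / 2 ^ n < e" if "e > 0" for e :: real
    using eventually_happens[OF order_tendstoD(2)[OF lim0 that]] by simp
  have "\<exists>l\<in>E1. p1 l = p2 y \<and> (\<forall>n. fdist \<xi>1 l (F n y) \<le> 4 / 2 ^ n)" if y: "y \<in> E2" for y
  proof -
    have "\<exists>N. \<forall>k. fdist \<xi>1 (F (N + k) y) (F N y) \<le> e" if "0 < e" for e
      using small[OF that] dist[OF y] by (meson less_imp_le order_trans)
    from b1.limit_exists[OF base2[OF y] FE(1)[OF y] FE(3)[OF y] this] dist[OF y]
    show ?thesis by blast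
  qed
  then obtain h where h: "\<And>y. y \<in> E2 \<Longrightarrow> h y \<in> E1" "\<And>y. y \<in> E2 \<Longrightarrow> p1 (h y) = p2 y"
    "\<And>y n. y \<in> E2 \<Longrightarrow> fdist \<xi>1 (h y) (F n y) \<le> 4 / 2 ^ n"
    by metis
  have "\<phi> (h y) = y" if y: "y \<in> E2" for y
  proof (rule phi_limit[OF h(1)[OF y]])
    fix e :: real assume "e > 0"
    then obtain n where "4 / 2 ^ n < e" using small by blast
    then show "\<exists>x\<in>E1. p1 x = p1 (h y) \<and> fdist \<xi>1 x (h y) < e \<and> \<phi> x = y"
      using h[OF y] FE[OF y] b1.fdist_commute[of "h y" "F n y"] h(3)[OF y, of n]
      by (intro bexI[of _ "F n y"]) auto
  qed
  moreover have "fnorm \<xi>1 (h y) \<le> m * fnorm \<xi>2 y + (m + 5)" if y: "y \<in> E2" for y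
    using b1.norm_le_dist[of "h y" "F 0 y"] h(1,2)[OF y] h(3)[OF y, of 0] FE[OF y, of 0] F[of 0] y
    by (simp add: good_def) fastforce
  moreover have "continuous_map X (bspace \<xi>1) h"
  proof (rule b1.continuous_if_near_cont[OF h(1)])
    fix a and e :: real assume a: "a \<in> E2" and e: "e > 0"
    obtain n where n: "4 / 2 ^ n < e / 4" using small[of "e / 4"] e by auto
    \<comment> \<open>\<open>near_cont_perturb\<close> uses one number for both errors, so the
      better value 1 / 2^n for \<open>F n\<close> is weakened to its distance bound 4 / 2^n.\<close>
    have "near_cont \<xi>1 X (\<lambda>_. 4 * (4 / 2 ^ n)) h a"
    proof (rule b1.near_cont_perturb[OF FE(1) h(1) _ _ a])
      show "p1 (F n y) = p1 (h y)" if "y \<in> E2" for y using that FE h by simp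
      show "continuous_map X (base \<xi>1) (\<lambda>y. p1 (h y))"
        by (rule continuous_map_eq[OF p2_continuous]) (simp add: h)
      show "near_cont \<xi>1 X (\<lambda>_. 4 / 2 ^ n) (F n) a"
        by (rule b1.near_cont_mono[OF FE(4)[OF a, of n] a]) (simp add: divide_right_mono)
      show "\<forall>\<^sub>F y in nhdsin X a. fdist \<xi>1 (h y) (F n y) \<le> 4 / 2 ^ n"
        using eventually_nhdsin_topspace by (rule eventually_mono) (rule h(3))
      show "0 < 4 / (2::real) ^ n" by (rule divide_pos_pos) auto
    qed
    then show "near_cont \<xi>1 X (\<lambda>_. e) h a"
      by (rule b1.near_cont_mono[OF _ a]) (use n in simp)
  qed
  ultimately show ?thesis by blast
qed

end

section \<open>Averaging over roots of unity\<close>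


lemma dist_cis_le: "dist (cis s) (cis t) \<le> \<bar>s - t\<bar>"
proof -
  have "cis s - cis t = cis t * (exp (\<i> * of_real (s - t)) - 1)"
    by (simp add: cis_conv_exp algebra_simps flip: exp_add)
  then have "dist (cis s) (cis t) = 2 * \<bar>sin ((s - t) / 2)\<bar>"
    using dist_exp_i_1[of "s - t"] by (simp add: dist_norm norm_mult)
  also have "\<dots> \<le> \<bar>s - t\<bar>"
    using abs_sin_x_le_abs_x[of "(s - t) / 2"] by simp
  finally show ?thesis .
qed

text \<open>The power on the right of \<open>\<omega> (Suc k) ^ 2 = \<omega> k ^ n\<close> is what admits the constant
  sequence \<open>-1\<close> needed for real scalars.\<close>

definition dense_roots :: "complex set \<Rightarrow> (nat \<Rightarrow> complex) \<Rightarrow> bool" where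
  "dense_roots G \<omega> \<longleftrightarrow> (\<forall>k. \<omega> k \<in> G) \<and> \<omega> 0 = 1 \<and> (\<forall>k. \<exists>n. \<omega> (Suc k) ^ 2 = \<omega> k ^ n) \<and>
    (\<forall>d>0. \<exists>k. \<forall>c\<in>G. \<exists>n. dist c (\<omega> k ^ n) < d)"

lemma dense_roots_circle: "dense_roots (sphere 0 1) (\<lambda>k. cis (2 * pi / 2 ^ k))"
proof -
  have "cis (2 * pi / 2 ^ Suc k) ^ 2 = cis (2 * pi / 2 ^ k) ^ 1" for k
    by (simp add: Complex.DeMoivre)
  then have sq: "\<exists>n. cis (2 * pi / 2 ^ Suc k) ^ 2 = cis (2 * pi / 2 ^ k) ^ n" for k
    by blast
  have "\<exists>k. \<forall>c\<in>sphere 0 1. \<exists>n. dist c (cis (2 * pi / 2 ^ k) ^ n) < d" if d: "d > 0" for d :: real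
  proof -
    have "(\<lambda>k. 2 * pi / 2 ^ k) \<longlonglongrightarrow> 0"
      using LIMSEQ_divide_realpow_zero[of 2 "2 * pi"] by simp
    then obtain k where k: "2 * pi / 2 ^ k < d"
      using eventually_happens[OF order_tendstoD(2)[OF _ d]] by fastforce
    define r where "r = 2 * pi / 2 ^ k"
    have r: "r > 0" by (simp add: r_def)
    have "\<exists>n. dist c (cis r ^ n) < d" if c: "c \<in> sphere 0 1" for c
    proof -
      define t where "t = Arg2pi c"
      have t: "0 \<le> t" "c = cis t"
        using Arg2pi[of c] c by (auto simp: t_def cis_conv_exp is_Arg_def)
      \<comment> \<open>Rounding the argument down to a multiple of r moves it by less than r, and a
        chord is no longer than its arc.\<close>
      define n where "n = nat \<lfloor>t / r\<rfloor>"
      have "real n \<le> t / r" "t / r < real n + 1"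
        using t r by (simp_all add: n_def)
      then have "real n * r \<le> t" "t < real n * r + r"
        using r by (simp_all add: field_simps)
      then have "dist (cis t) (cis (real n * r)) < d"
        using dist_cis_le[of t "real n * r"] k by (simp add: r_def)
      then show ?thesis
        unfolding t(2) Complex.DeMoivre by blast
    qed
    then show ?thesis unfolding r_def by blast
  qed
  with sq show ?thesis by (simp add: dense_roots_def)
qed

lemma dense_roots_signs: "dense_roots {1, -1} (\<lambda>k. if k = 0 then 1 else -1)"
  unfolding dense_roots_def
proof (intro conjI allI impI)
  show "\<exists>n. (if Suc k = 0 then 1 else - 1 :: complex) ^ 2 = (if k = 0 then 1 else - 1) ^ n" for k
    by (rule exI[of _ 0]) simp
  show "\<exists>k::nat. \<forall>c\<in>{1, -1}. \<exists>n. dist c ((if k = 0 then 1 else - 1 :: complex) ^ n) < d" if "d > 0" for d :: real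
  proof (rule exI[of _ "1::nat"], rule ballI)
    fix c :: complex assume "c \<in> {1, -1}"
    then have "dist c ((- 1) ^ (if c = 1 then 0 else 1)) < d" using that by auto
    then show "\<exists>n. dist c ((if (1::nat) = 0 then 1 else - 1 :: complex) ^ n) < d" by auto
  qed
qed auto

section \<open>Continuity of the fiberwise operations\<close>

context scalar_bundle
begin

lemma continuous_add:
  assumes f: "continuous_map X (bspace \<xi>) f" and h: "continuous_map X (bspace \<xi>) h"
    and pf: "\<And>y. y \<in> topspace X \<Longrightarrow> p (f y) = p (h y)"
  shows "continuous_map X (bspace \<xi>) (\<lambda>y. fadd \<xi> (f y) (h y))"
proof (rule continuous_map_if_eventually)
  have E: "f y \<in> E" "h y \<in> E" if "y \<in> topspace X" for y
    using continuous_map_image_subset_topspace[OF f] continuous_map_image_subset_topspace[OF h] that by auto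
  then show "fadd \<xi> (f y) (h y) \<in> E" if "y \<in> topspace X" for y
    using that pf by (simp add: add_E)
  fix a S assume a: "a \<in> topspace X" and S: "is_open S" "fadd \<xi> (f a) (h a) \<in> S"
  obtain A B where AB: "is_open A" "f a \<in> A" "is_open B" "h a \<in> B"
    "\<forall>a\<in>A. \<forall>b\<in>B. p a = p b \<longrightarrow> fadd \<xi> a b \<in> S"
    using add_nbhd[OF S(1) E[OF a] pf[OF a] S(2)] by blast
  show "\<forall>\<^sub>F y in nhdsin X a. fadd \<xi> (f y) (h y) \<in> S"
    using eventually_nhdsin_continuous[OF f AB(1) a AB(2)] eventually_nhdsin_continuous[OF h AB(3) a AB(4)]
      eventually_nhdsin_topspace
    by eventually_elim (use AB(5) pf in auto)
qed

lemma continuous_scale: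
  assumes h: "continuous_map X (bspace \<xi>) h" and c: "continuous_map X euclidean c"
    and cK: "\<And>y. y \<in> topspace X \<Longrightarrow> c y \<in> K"
  shows "continuous_map X (bspace \<xi>) (\<lambda>y. fscale \<xi> (c y) (h y))"
proof (rule continuous_map_if_eventually)
  have E: "h y \<in> E" if "y \<in> topspace X" for y
    using continuous_map_image_subset_topspace[OF h] that by auto
  then show "fscale \<xi> (c y) (h y) \<in> E" if "y \<in> topspace X" for y
    using that cK by (simp add: scale_E)
  fix a S assume a: "a \<in> topspace X" and S: "is_open S" "fscale \<xi> (c a) (h a) \<in> S"
  obtain d A where A: "d > 0" "is_open A" "h a \<in> A" "\<forall>k\<in>K. \<forall>x\<in>A. dist k (c a) < d \<longrightarrow> fscale \<xi> k x \<in> S"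
    using scale_nbhd[OF S(1) E[OF a] cK[OF a] S(2)] by blast
  have "\<forall>\<^sub>F y in nhdsin X a. c y \<in> ball (c a) d"
    by (rule eventually_nhdsin_continuous[OF c _ a]) (use A in auto)
  with eventually_nhdsin_continuous[OF h A(2) a A(3)] eventually_nhdsin_topspace
  show "\<forall>\<^sub>F y in nhdsin X a. fscale \<xi> (c y) (h y) \<in> S"
    by eventually_elim (use A(4) cK in \<open>auto simp: dist_commute\<close>)
qed

lemma half_self: "x \<in> E \<Longrightarrow> fscale \<xi> (1 / 2) (fadd \<xi> x x) = x"
  using add_scale[of "1 / 2" "1 / 2" x] scale_add[of "1 / 2" x x] K_simps(1)[of "1 / 2"]
  by (simp add: scale_one)

end

context bundle_lifting
begin

section \<open>The action of unit scalars on lifts\<close>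

definition clift :: "('f \<Rightarrow> 'e) \<Rightarrow> bool" where
  "clift f \<longleftrightarrow> continuous_map X (bspace \<xi>1) f \<and> (\<forall>y\<in>E2. \<phi> (f y) = y)"

text \<open>Conjugation by c. Lifts fixed by \<open>rot c\<close> for all unit scalars c are exactly
  those equivariant under unit scalars.\<close>

definition rot :: "complex \<Rightarrow> ('f \<Rightarrow> 'e) \<Rightarrow> 'f \<Rightarrow> 'e" where
  "rot c f y = fscale \<xi>1 (inverse c) (f (fscale \<xi>2 c y))"

text \<open>If f is fixed by the square of c, then conjugation by c merely swaps the two
  summands.\<close>

definition avg :: "complex \<Rightarrow> ('f \<Rightarrow> 'e) \<Rightarrow> 'f \<Rightarrow> 'e" where
  "avg c f y = fscale \<xi>1 (1 / 2) (fadd \<xi>1 (f y) (rot c f y))"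

definition G :: "complex set" where
  "G = K \<inter> sphere 0 1"

lemma K_cases: "K = \<real> \<or> K = UNIV"
  by (rule b1.scalars)

lemma half_K [simp]: "(1 / 2) \<in> K"
  using b1.K_simps(1)[of "1 / 2"] by simp

lemma G_simps [simp]: "c \<in> G \<Longrightarrow> c \<in> K" "c \<in> G \<Longrightarrow> c \<noteq> 0" "c \<in> G \<Longrightarrow> cmod c = 1" "1 \<in> G"
  by (auto simp: G_def)

lemma G_inverse [simp]: "c \<in> G \<Longrightarrow> inverse c \<in> G"
  using K_cases by (auto simp: G_def norm_inverse simp del: G_simps)

lemma G_mult [simp]: "c \<in> G \<Longrightarrow> d \<in> G \<Longrightarrow> c * d \<in> G"
  using K_cases by (auto simp: G_def norm_mult simp del: G_simps)

lemma G_power [simp]: "c \<in> G \<Longrightarrow> c ^ n \<in> G"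
  by (induction n) auto

lemma G_compact: "compact G"
proof -
  have "closed K" using K_cases closed_complex_Reals by auto
  then show ?thesis unfolding G_def by (intro closed_Int_compact) auto
qed

lemma G_dense_roots: "\<exists>\<omega>. dense_roots G \<omega>"
proof -
  have "G = {1, -1}" if R: "K = \<real>"
  proof -
    have signs: "x = 1 \<or> x = -1" if "x \<in> \<real>" "cmod x = 1" for x
      using that by (auto elim!: Reals_cases simp: abs_if split: if_splits)
    show ?thesis unfolding G_def unfolding R by (auto dest: signs)
  qed
  moreover have "G = sphere 0 1" if "K = UNIV" unfolding G_def unfolding that by simp
  ultimately show ?thesis
    using K_cases dense_roots_circle dense_roots_signs by metis
qed

lemma clift_E:
  assumes "clift f" "y \<in> E2"
  shows "f y \<in> E1" "\<phi> (f y) = y" "p1 (f y) = p2 y"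
proof -
  show 1: "f y \<in> E1" "\<phi> (f y) = y"
    using assms continuous_map_image_subset_topspace[of X "bspace \<xi>1" f] by (auto simp: clift_def)
  show "p1 (f y) = p2 y" using phi_p[OF 1(1)] 1(2) by simp
qed

lemma rot_clift:
  assumes f: "clift f" and c: "c \<in> G" shows "clift (rot c f)"
proof -
  have "continuous_map X X (\<lambda>y. fscale \<xi>2 c y)"
    by (rule b2.continuous_scale) (use c in auto)
  then have "continuous_map X (bspace \<xi>1) (\<lambda>y. f (fscale \<xi>2 c y))"
    using f continuous_map_compose[of X X "\<lambda>y. fscale \<xi>2 c y" "bspace \<xi>1" f] by (simp add: clift_def o_def)
  then have "continuous_map X (bspace \<xi>1) (rot c f)"
    unfolding rot_def by (rule b1.continuous_scale) (use c in auto)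
  moreover have "\<phi> (rot c f y) = y" if "y \<in> E2" for y
    using that c clift_E[OF f, of "fscale \<xi>2 c y"]
    by (simp add: rot_def phi_scale b2.E_p b2.scale_scale b2.scale_one)
  ultimately show ?thesis by (simp add: clift_def)
qed

lemma avg_clift:
  assumes f: "clift f" and c: "c \<in> G" shows "clift (avg c f)"
proof -
  note r = rot_clift[OF f c]
  have "continuous_map X (bspace \<xi>1) (\<lambda>y. fadd \<xi>1 (f y) (rot c f y))"
    by (rule b1.continuous_add) (use f r in \<open>simp_all add: clift_E(3)[OF f] clift_E(3)[OF r] clift_def\<close>)
  then have "continuous_map X (bspace \<xi>1) (avg c f)"
    unfolding avg_def by (rule b1.continuous_scale) auto
  moreover have "\<phi> (avg c f y) = y" if "y \<in> E2" for y
    using that clift_E[OF f that] clift_E[OF r that]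
    by (simp add: avg_def phi_scale phi_add b1.E_p b2.half_self)
  ultimately show ?thesis by (simp add: clift_def)
qed

lemma rot_one: "clift f \<Longrightarrow> y \<in> E2 \<Longrightarrow> rot 1 f y = f y"
  by (simp add: rot_def b1.scale_one b2.scale_one clift_E(1)[of f])

lemma rot_rot: "\<lbrakk>clift f; y \<in> E2; c \<in> G; d \<in> G\<rbrakk> \<Longrightarrow> rot c (rot d f) y = rot (c * d) f y"
  by (simp add: rot_def b1.scale_scale b2.scale_scale b2.E_p clift_E(1)[of f] mult.commute)

lemma rot_avg:
  assumes f: "clift f" and y: "y \<in> E2" and c: "c \<in> G" and d: "d \<in> G"
  shows "rot c (avg d f) y = fscale \<xi>1 (1 / 2) (fadd \<xi>1 (rot c f y) (rot (c * d) f y))"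
proof -
  let ?z = "fscale \<xi>2 c y"
  have z: "?z \<in> E2" "p2 ?z = p2 y" using y c by (simp_all add: b2.E_p)
  note fz = clift_E[OF f z(1)] clift_E[OF rot_clift[OF f d] z(1)]
  have "rot c (avg d f) y = fscale \<xi>1 (inverse c) (fscale \<xi>1 (1 / 2) (fadd \<xi>1 (f ?z) (rot d f ?z)))"
    by (simp add: rot_def[of c] avg_def)
  also have "\<dots> = fscale \<xi>1 (1 / 2) (fscale \<xi>1 (inverse c) (fadd \<xi>1 (f ?z) (rot d f ?z)))"
    using c fz by (simp add: b1.scale_scale b1.E_p mult.commute)
  also have "\<dots> = fscale \<xi>1 (1 / 2) (fadd \<xi>1 (rot c f y) (rot c (rot d f) y))"
    using c fz by (simp add: b1.scale_add rot_def[of c])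
  finally show ?thesis using rot_rot[OF f y c d] by simp
qed

lemma fdist_half_sum:
  assumes "x \<in> E1" "y \<in> E1" "x' \<in> E1" "y' \<in> E1" "p1 x = p1 y" "p1 x' = p1 y" "p1 y' = p1 y"
    and "fdist \<xi>1 x x' \<le> e" "fdist \<xi>1 y y' \<le> e"
  shows "fdist \<xi>1 (fscale \<xi>1 (1 / 2) (fadd \<xi>1 x y)) (fscale \<xi>1 (1 / 2) (fadd \<xi>1 x' y')) \<le> e"
  using assms b1.fdist_add[of x y x' y'] by (simp add: b1.fdist_scale b1.E_p)

text \<open>For each c, joint continuity of scalar multiplication keeps the conjugates of f by
  scalars near c inside one thin set, over a neighbourhood of a. Compactness of G reduces this to
  finitely many c, so a single neighbourhood of a suffices.\<close>

lemma rot_uniform: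
  assumes f: "clift f" and a: "a \<in> E2" and e: "e > 0"
  shows "\<exists>W d. openin X W \<and> a \<in> W \<and> d > 0 \<and>
    (\<forall>y\<in>W. \<forall>c\<in>G. \<forall>c'\<in>G. dist c c' < d \<longrightarrow> fdist \<xi>1 (rot c f y) (rot c' f y) \<le> e)"
proof -
  have "\<exists>T W. open T \<and> c \<in> T \<and> openin X W \<and> a \<in> W \<and>
      (\<forall>y\<in>W. \<forall>k\<in>G \<inter> T. \<forall>k'\<in>G \<inter> T. fdist \<xi>1 (rot k f y) (rot k' f y) \<le> e)" if c: "c \<in> G" for c
  proof -
    let ?b = "fscale \<xi>2 c a"
    have b: "?b \<in> E2" using a c by (simp add: b2.E_p)
    obtain S where S: "b1.is_open S" "rot c f a \<in> S" "\<forall>x\<in>S. \<forall>x'\<in>S. p1 x = p1 x' \<longrightarrow> fdist \<xi>1 x x' < e"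
      using b1.thin_nbhd[OF clift_E(1)[OF rot_clift[OF f c] a] e] by blast
    obtain d1 A where A: "d1 > 0" "b1.is_open A" "f ?b \<in> A"
      "\<forall>k\<in>K. \<forall>x\<in>A. dist k (inverse c) < d1 \<longrightarrow> fscale \<xi>1 k x \<in> S"
      using b1.scale_nbhd[OF S(1) clift_E(1)[OF f b] _ S(2)[unfolded rot_def]] c G_simps(1)[OF G_inverse[OF c]] by blast
    have "openin X {y \<in> E2. f y \<in> A}" "?b \<in> {y \<in> E2. f y \<in> A}"
      using f A b by (auto simp: clift_def intro: openin_continuous_map_preimage)
    from b2.scale_nbhd[OF this(1) a G_simps(1)[OF c] this(2)]
    obtain d2 W where W: "d2 > 0" "openin X W" "a \<in> W"
      "\<forall>k\<in>K. \<forall>y\<in>W. dist k c < d2 \<longrightarrow> fscale \<xi>2 k y \<in> {y \<in> E2. f y \<in> A}" by blast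
    have inS: "rot k f y \<in> S" if "y \<in> W" "k \<in> G" "dist k c < min d1 d2" for y k
    proof -
      have "inverse k - inverse c = inverse k * (c - k) * inverse c"
        using that c by (simp add: field_simps)
      then have "dist (inverse k) (inverse c) = dist k c"
        using that c by (simp add: dist_norm norm_mult norm_inverse norm_minus_commute)
      then have "dist (inverse k) (inverse c) < d1" using that by simp
      moreover have "f (fscale \<xi>2 k y) \<in> A" using W(4) that by auto
      ultimately show ?thesis
        unfolding rot_def using A(4) that by simp
    qed
    have "fdist \<xi>1 (rot k f y) (rot k' f y) \<le> e"
      if "y \<in> W" "k \<in> G \<inter> ball c (min d1 d2)" "k' \<in> G \<inter> ball c (min d1 d2)" for y k k'
    proof -
      have "y \<in> E2" using that W(2) b2.open_E by blast
      then have "p1 (rot k f y) = p1 (rot k' f y)"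
        using that clift_E(3)[OF rot_clift[OF f]] by simp
      moreover have "rot k f y \<in> S" "rot k' f y \<in> S"
        using that inS by (simp_all add: dist_commute)
      ultimately show ?thesis using S(3) by (simp add: less_imp_le)
    qed
    with A(1) W(1-3) show ?thesis
      by (intro exI[of _ "ball c (min d1 d2)"] exI[of _ W]) auto
  qed
  then obtain T W where TW: "\<And>c. c \<in> G \<Longrightarrow> open (T c) \<and> c \<in> T c \<and> openin X (W c) \<and> a \<in> W c \<and>
      (\<forall>y\<in>W c. \<forall>k\<in>G \<inter> T c. \<forall>k'\<in>G \<inter> T c. fdist \<xi>1 (rot k f y) (rot k' f y) \<le> e)"
    by metis
  have close: "fdist \<xi>1 (rot k f y) (rot k' f y) \<le> e"
    if "c \<in> G" "y \<in> W c" "k \<in> G \<inter> T c" "k' \<in> G \<inter> T c" for c y k k'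
    using TW[OF that(1)] that(2-) by blast
  have G_T: "G \<subseteq> (\<Union>c\<in>G. T c)" "\<And>c. c \<in> G \<Longrightarrow> open (T c)" using TW by blast+
  obtain D where D: "D \<subseteq> G" "finite D" "G \<subseteq> (\<Union>c\<in>D. T c)"
    using compactE_image[OF G_compact G_T(2) G_T(1)] by auto
  have opT: "\<And>B. B \<in> T ` D \<Longrightarrow> open B" using D(1) TW by blast
  \<comment> \<open>d is a Lebesgue number of the finite cover: scalars at distance < d lie in a
    common member.\<close>
  obtain d where d: "d > 0" "\<And>c. c \<in> G \<Longrightarrow> \<exists>B\<in>T ` D. ball c d \<subseteq> B"
    using Heine_Borel_lemma[OF G_compact D(3) opT] by auto
  have "D \<noteq> {}" using D(3) G_simps(4) by blast
  then have "openin X (\<Inter>c\<in>D. W c)" "a \<in> (\<Inter>c\<in>D. W c)"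
    using D TW by (auto intro!: openin_INT2)
  moreover have "fdist \<xi>1 (rot c f y) (rot c' f y) \<le> e"
    if y: "y \<in> (\<Inter>c\<in>D. W c)" and c: "c \<in> G" "c' \<in> G" "dist c c' < d" for y c c'
  proof -
    obtain k where k: "k \<in> D" "ball c d \<subseteq> T k" using d(2)[OF c(1)] by blast
    then have "c \<in> G \<inter> T k" "c' \<in> G \<inter> T k" using c d(1) by auto
    moreover have "k \<in> G" "y \<in> W k" using k(1) D(1) y by auto
    ultimately show ?thesis using close by blast
  qed
  ultimately show ?thesis using d(1) by (intro exI[of _ "\<Inter>c\<in>D. W c"] exI[of _ d]) simp
qed

section \<open>Iterated averages and their limit\<close>

primrec iter_avg :: "(nat \<Rightarrow> complex) \<Rightarrow> ('f \<Rightarrow> 'e) \<Rightarrow> nat \<Rightarrow> 'f \<Rightarrow> 'e" where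
  "iter_avg \<omega> f 0 = f"
| "iter_avg \<omega> f (Suc k) = avg (\<omega> (Suc k)) (iter_avg \<omega> f k)"

context
  fixes \<omega> :: "nat \<Rightarrow> complex" and f :: "'f \<Rightarrow> 'e"
  assumes \<omega>: "dense_roots G \<omega>" and f: "clift f"
begin

lemma \<omega>_G [simp]: "\<omega> k \<in> G"
  using \<omega> by (simp add: dense_roots_def)

lemma iter_clift: "clift (iter_avg \<omega> f k)"
  by (induction k) (simp_all add: f avg_clift)

lemmas iter_E = clift_E[OF iter_clift] clift_E[OF rot_clift[OF iter_clift]]

text \<open>The modulus d for e does not deteriorate with k: conjugates of an average are half-sums
  of conjugates one stage earlier, and multiplying both scalars by the same unit scalar preserves
  their distance.\<close>

lemma iter_uniform:
  assumes y: "y \<in> E2"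
    and u: "\<And>c c'. \<lbrakk>c \<in> G; c' \<in> G; dist c c' < d\<rbrakk> \<Longrightarrow> fdist \<xi>1 (rot c f y) (rot c' f y) \<le> e"
  shows "\<lbrakk>c \<in> G; c' \<in> G; dist c c' < d\<rbrakk> \<Longrightarrow>
    fdist \<xi>1 (rot c (iter_avg \<omega> f k) y) (rot c' (iter_avg \<omega> f k) y) \<le> e"
proof (induction k arbitrary: c c')
  case 0
  then show ?case using u by simp
next
  case (Suc k)
  let ?w = "\<omega> (Suc k)"
  have "dist (c * ?w) (c' * ?w) = dist c c'"
    by (simp add: dist_norm norm_mult flip: left_diff_distrib)
  then show ?case
    using Suc y by (simp add: rot_avg[OF iter_clift y]) (rule fdist_half_sum, simp_all add: iter_E)
qed

text \<open>Balls are convex, and conjugates at a later stage are half-sums of conjugates one stage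
  earlier. The hypothesis must cover all of G because averaging changes the scalar.\<close>

lemma iter_ball:
  assumes y: "y \<in> E2" and z: "z \<in> E1" "p1 z = p2 y"
    and b: "\<And>c. c \<in> G \<Longrightarrow> fdist \<xi>1 (rot c (iter_avg \<omega> f k) y) z \<le> e"
  shows "c \<in> G \<Longrightarrow> fdist \<xi>1 (rot c (iter_avg \<omega> f (k + j)) y) z \<le> e"
proof (induction j arbitrary: c)
  case 0
  then show ?case using b by simp
next
  case (Suc j)
  have "fdist \<xi>1 (fscale \<xi>1 (1 / 2) (fadd \<xi>1 (rot c (iter_avg \<omega> f (k + j)) y)
      (rot (c * \<omega> (Suc (k + j))) (iter_avg \<omega> f (k + j)) y))) (fscale \<xi>1 (1 / 2) (fadd \<xi>1 z z)) \<le> e"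
    using Suc y z by (intro fdist_half_sum) (simp_all add: iter_E)
  then show ?case
    using Suc.prems z by (simp add: rot_avg[OF iter_clift y] b1.half_self)
qed

text \<open>In the step, write w for the new root. Its square is a power of the previous root, hence
  fixes the previous average, so conjugation by w swaps the two halves of the new one.\<close>

lemma iter_invariant:
  assumes y: "y \<in> E2"
  shows "rot (\<omega> k ^ n) (iter_avg \<omega> f k) y = iter_avg \<omega> f k y"
proof -
  \<comment> \<open>Invariance under c is assumed at every point, since conjugating by a further
    power evaluates it at a multiple of y.\<close>
  have powers: "rot (c ^ n) h y = h y" if "clift h" "c \<in> G" "\<And>y. y \<in> E2 \<Longrightarrow> rot c h y = h y" "y \<in> E2" for c h n y
  proof (induction n)
    case 0
    then show ?case using that by (simp add: rot_one)
  next
    case (Suc n)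
    have "rot (c ^ Suc n) h y = rot (c ^ n) (rot c h) y"
      using that rot_rot[of h y "c ^ n" c] by (simp add: mult.commute)
    also have "\<dots> = rot (c ^ n) h y"
      using that by (simp add: rot_def[of "c ^ n"] b2.E_p)
    finally show ?case using Suc by simp
  qed
  have "rot (\<omega> k) (iter_avg \<omega> f k) y = iter_avg \<omega> f k y" if "y \<in> E2" for y
    using that
  proof (induction k arbitrary: y)
    case 0
    then show ?case using \<omega> rot_one[OF f] by (simp add: dense_roots_def)
  next
    case (Suc k)
    let ?w = "\<omega> (Suc k)" and ?h = "iter_avg \<omega> f k"
    obtain n where n: "?w ^ 2 = \<omega> k ^ n" using \<omega> unfolding dense_roots_def by blast
    have "rot (?w * ?w) ?h y = ?h y"
      using powers[OF iter_clift \<omega>_G Suc.IH Suc.prems, of n] n by (simp add: power2_eq_square)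
    then have "rot ?w (avg ?w ?h) y = fscale \<xi>1 (1 / 2) (fadd \<xi>1 (rot ?w ?h y) (?h y))"
      using rot_avg[OF iter_clift Suc.prems, of ?w ?w] by simp
    also have "\<dots> = avg ?w ?h y"
      unfolding avg_def using b1.add_commute[of "?h y" "rot ?w ?h y"] Suc.prems by (simp add: iter_E)
    finally show ?case by simp
  qed
  from powers[OF iter_clift \<omega>_G this y] show ?thesis .
qed

text \<open>Choose k so that the powers of \<open>\<omega> k\<close> come within d of every unit
  scalar. The k-th average is fixed by these powers, so all its conjugates are within e of it near
  a; convexity extends the estimate to all later stages.\<close>

lemma iter_locally_cauchy:
  assumes a: "a \<in> E2" and e: "e > 0"
  shows "\<exists>W k. openin X W \<and> a \<in> W \<and>
    (\<forall>y\<in>W. \<forall>j. \<forall>c\<in>G. fdist \<xi>1 (rot c (iter_avg \<omega> f (k + j)) y) (iter_avg \<omega> f k y) \<le> e)"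
proof -
  obtain W d where W: "openin X W" "a \<in> W" "d > 0"
    "\<forall>y\<in>W. \<forall>c\<in>G. \<forall>c'\<in>G. dist c c' < d \<longrightarrow> fdist \<xi>1 (rot c f y) (rot c' f y) \<le> e"
    using rot_uniform[OF f a e] by blast
  obtain k where k: "\<forall>c\<in>G. \<exists>n. dist c (\<omega> k ^ n) < d"
    using \<omega> W(3) unfolding dense_roots_def by blast
  have "fdist \<xi>1 (rot c (iter_avg \<omega> f (k + j)) y) (iter_avg \<omega> f k y) \<le> e"
    if yW: "y \<in> W" and c: "c \<in> G" for y j c
  proof -
    have y: "y \<in> E2" using b2.open_E[OF W(1) yW] .
    have "fdist \<xi>1 (rot c (iter_avg \<omega> f k) y) (iter_avg \<omega> f k y) \<le> e" if c: "c \<in> G" for c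
    proof -
      obtain n where "dist c (\<omega> k ^ n) < d" using k c by blast
      then show ?thesis
        using iter_uniform[OF y, of d e c "\<omega> k ^ n" k] W(4) yW c iter_invariant[OF y, of k n] by simp
    qed
    from iter_ball[OF y _ _ this c] show ?thesis by (simp add: iter_E y)
  qed
  with W(1,2) show ?thesis by blast
qed

text \<open>The stage k depends on the point, so the limit is taken fiber by fiber; its estimates
  are nevertheless uniform on a neighbourhood, because \<open>hA\<close> transfers any bound on a
  tail.\<close>

lemma invariant_limit:
  assumes bound: "\<And>y. y \<in> E2 \<Longrightarrow> fnorm \<xi>1 (f y) \<le> m * fnorm \<xi>2 y + M"
  shows "\<exists>h. clift h \<and> (\<forall>y\<in>E2. fnorm \<xi>1 (h y) \<le> m * fnorm \<xi>2 y + M \<and> (\<forall>c\<in>G. rot c h y = h y))"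
proof -
  let ?A = "iter_avg \<omega> f"
  have "\<exists>l\<in>E1. p1 l = p2 y \<and>
      (\<forall>N e. (\<forall>k. fdist \<xi>1 (?A (N + k) y) (?A N y) \<le> e) \<longrightarrow> fdist \<xi>1 l (?A N y) \<le> e)" if y: "y \<in> E2" for y
  proof (rule b1.limit_exists[OF base2[OF y]])
    fix e :: real assume "0 < e"
    from iter_locally_cauchy[OF y this] obtain k where
      "\<forall>j. fdist \<xi>1 (rot 1 (?A (k + j)) y) (?A k y) \<le> e" by force
    then show "\<exists>N. \<forall>k. fdist \<xi>1 (?A (N + k) y) (?A N y) \<le> e"
      using y by (auto simp: rot_one[OF iter_clift])
  qed (simp_all add: iter_E y)
  then obtain h where h: "\<And>y. y \<in> E2 \<Longrightarrow> h y \<in> E1" "\<And>y. y \<in> E2 \<Longrightarrow> p1 (h y) = p2 y"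
    and hA: "\<And>y N e. \<lbrakk>y \<in> E2; \<And>k. fdist \<xi>1 (?A (N + k) y) (?A N y) \<le> e\<rbrakk> \<Longrightarrow> fdist \<xi>1 (h y) (?A N y) \<le> e"
    by metis
  have approx: "\<exists>W k. openin X W \<and> a \<in> W \<and> (\<forall>y\<in>W. fdist \<xi>1 (h y) (?A k y) \<le> e \<and>
      (\<forall>j. \<forall>c\<in>G. fdist \<xi>1 (rot c (?A (k + j)) y) (?A k y) \<le> e))" if a: "a \<in> E2" and e: "e > 0" for a e
  proof -
    obtain W k where W: "openin X W" "a \<in> W"
      "\<forall>y\<in>W. \<forall>j. \<forall>c\<in>G. fdist \<xi>1 (rot c (?A (k + j)) y) (?A k y) \<le> e"
      using iter_locally_cauchy[OF a e] by blast
    have "fdist \<xi>1 (h y) (?A k y) \<le> e" if "y \<in> W" for y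
    proof (rule hA)
      show y: "y \<in> E2" using b2.open_E[OF W(1) that] .
      show "fdist \<xi>1 (?A (k + j) y) (?A k y) \<le> e" for j
        using W(3)[rule_format, OF that, of 1 j] rot_one[OF iter_clift y] by simp
    qed
    with W show ?thesis by blast
  qed
  have "\<phi> (h y) = y" if y: "y \<in> E2" for y
  proof (rule phi_limit[OF h(1)[OF y]])
    fix e :: real assume "e > 0"
    then obtain k where "fdist \<xi>1 (h y) (?A k y) \<le> e / 2" using approx[OF y, of "e / 2"] by auto
    then have "fdist \<xi>1 (?A k y) (h y) < e"
      using b1.fdist_commute[of "h y" "?A k y"] h[OF y] iter_E(1,3)[OF y] \<open>e > 0\<close> by simp
    then show "\<exists>x\<in>E1. p1 x = p1 (h y) \<and> fdist \<xi>1 x (h y) < e \<and> \<phi> x = y"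
      using iter_E(1-3)[OF y] h[OF y] by (intro bexI[of _ "?A k y"]) auto
  qed
  moreover have "continuous_map X (bspace \<xi>1) h"
  proof (rule b1.continuous_if_near_cont[OF h(1)])
    fix a and e :: real assume a: "a \<in> E2" and e: "e > 0"
    obtain W k where W: "openin X W" "a \<in> W" "\<forall>y\<in>W. fdist \<xi>1 (h y) (?A k y) \<le> e / 4"
      using approx[OF a, of "e / 4"] e by auto
    have "near_cont \<xi>1 X (\<lambda>_. 4 * (e / 4)) h a"
    proof (rule b1.near_cont_perturb[OF iter_E(1) h(1) _ _ a])
      show "p1 (?A k y) = p1 (h y)" if "y \<in> E2" for y using that iter_E h by simp
      show "continuous_map X (base \<xi>1) (\<lambda>y. p1 (h y))"
        by (rule continuous_map_eq[OF p2_continuous]) (simp add: h)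
      show "near_cont \<xi>1 X (\<lambda>_. e / 4) (?A k) a"
        by (rule b1.near_cont_continuous[OF _ a]) (use iter_clift e in \<open>auto simp: clift_def\<close>)
      show "\<forall>\<^sub>F y in nhdsin X a. fdist \<xi>1 (h y) (?A k y) \<le> e / 4"
        using eventually_nhdsin_open[OF W(1,2)] by (rule eventually_mono) (use W in blast)
    qed (use e in auto)
    then show "near_cont \<xi>1 X (\<lambda>_. e) h a" by simp
  qed
  ultimately have ch: "clift h" by (simp add: clift_def)
  have "fnorm \<xi>1 (h y) \<le> m * fnorm \<xi>2 y + M" if y: "y \<in> E2" for y
  proof (rule field_le_epsilon)
    fix e :: real assume "e > 0"
    then obtain k where k: "fdist \<xi>1 (h y) (?A k y) \<le> e" using approx[OF y] by blast
    \<comment> \<open>Unit scalars preserve norms, so all conjugates of f at y lie in the ball of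
      this radius around the zero vector, and \<open>iter_ball\<close> from stage 0 keeps every
      average there.\<close>
    have "fdist \<xi>1 (rot c f y) (fzero \<xi>1 (p2 y)) \<le> m * fnorm \<xi>2 y + M" if c: "c \<in> G" for c
    proof -
      have "fscale \<xi>2 c y \<in> E2" using y c by (simp add: b2.E_p)
      then show ?thesis
        using bound[of "fscale \<xi>2 c y"] b1.fdist_zero[of "rot c f y"] clift_E[OF rot_clift[OF f c] y] y c clift_E[OF f, of "fscale \<xi>2 c y"]
        by (simp add: rot_def b1.norm_scale b2.norm_scale norm_inverse)
    qed
    then have "fdist \<xi>1 (rot 1 (?A (0 + k)) y) (fzero \<xi>1 (p2 y)) \<le> m * fnorm \<xi>2 y + M"
      by (intro iter_ball) (simp_all add: y base2 b1.E_p)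
    then have "fnorm \<xi>1 (?A k y) \<le> m * fnorm \<xi>2 y + M"
      using b1.fdist_zero[of "?A k y"] iter_E(1,3)[OF y] by (simp add: rot_one[OF iter_clift y])
    then show "fnorm \<xi>1 (h y) \<le> m * fnorm \<xi>2 y + M + e"
      using b1.norm_le_dist[of "h y" "?A k y"] h[OF y] iter_E(1,3)[OF y] k by simp
  qed
  moreover have "rot c h y = h y" if y: "y \<in> E2" and c: "c \<in> G" for y c
  proof -
    have rE: "rot c h y \<in> E1" "p1 (rot c h y) = p2 y" using clift_E[OF rot_clift[OF ch c] y] by auto
    have cy: "fscale \<xi>2 c y \<in> E2" "p2 (fscale \<xi>2 c y) = p2 y" using y c by (simp_all add: b2.E_p)
    have "fdist \<xi>1 (rot c h y) (h y) \<le> e" if e: "e > 0" for e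
    proof -
      have e4: "e / 4 > 0" using e by simp
      obtain k where k: "fdist \<xi>1 (h y) (?A k y) \<le> e / 4"
        "\<And>j c. c \<in> G \<Longrightarrow> fdist \<xi>1 (rot c (?A (k + j)) y) (?A k y) \<le> e / 4"
        using approx[OF y e4] by blast
      obtain l where l: "fdist \<xi>1 (h (fscale \<xi>2 c y)) (?A l (fscale \<xi>2 c y)) \<le> e / 4"
        "\<And>j d. d \<in> G \<Longrightarrow> fdist \<xi>1 (rot d (?A (l + j)) (fscale \<xi>2 c y)) (?A l (fscale \<xi>2 c y)) \<le> e / 4"
        using approx[OF cy(1) e4] by blast
      \<comment> \<open>Invariance compares h at y and at c y, where the estimates start at
        different stages k and l; stage k + l is late enough for both. The errors are e / 2, e / 4
        and e / 4.\<close>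
      let ?B = "?A (k + l)"
      have 1: "fdist \<xi>1 (?B (fscale \<xi>2 c y)) (?A l (fscale \<xi>2 c y)) \<le> e / 4"
        using l(2)[of 1 k] rot_one[OF iter_clift cy(1)] by (simp add: add.commute)
      have "fdist \<xi>1 (h (fscale \<xi>2 c y)) (?B (fscale \<xi>2 c y)) \<le> e / 2"
        using b1.fdist_triangle[of "h (fscale \<xi>2 c y)" "?A l (fscale \<xi>2 c y)" "?B (fscale \<xi>2 c y)"]
          b1.fdist_commute[of "?A l (fscale \<xi>2 c y)" "?B (fscale \<xi>2 c y)"] h[OF cy(1)] iter_E(1-3)[OF cy(1)] l(1) 1
        by simp
      then have 2: "fdist \<xi>1 (rot c h y) (rot c ?B y) \<le> e / 2"
        using c h[OF cy(1)] iter_E(1-3)[OF cy(1)] by (simp add: rot_def b1.fdist_scale norm_inverse)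
      have "fdist \<xi>1 (rot c h y) (h y) \<le>
          fdist \<xi>1 (rot c h y) (rot c ?B y) + (fdist \<xi>1 (rot c ?B y) (?A k y) + fdist \<xi>1 (?A k y) (h y))"
        using b1.fdist_triangle[of "rot c h y" "rot c ?B y" "h y"] b1.fdist_triangle[of "rot c ?B y" "?A k y" "h y"]
          rE h[OF y] iter_E(1-3)[OF y] iter_E(4-)[OF c y] by simp
      moreover have "fdist \<xi>1 (?A k y) (h y) \<le> e / 4"
        using k(1) b1.fdist_commute[of "h y" "?A k y"] h[OF y] iter_E(1,3)[OF y] by simp
      ultimately show ?thesis using 2 k(2)[OF c, of l] by simp
    qed
    then have "fdist \<xi>1 (rot c h y) (h y) \<le> 0" by (rule field_le_epsilon) simp
    then have "fdist \<xi>1 (rot c h y) (h y) = 0"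
      using b1.fdist_nonneg[of "rot c h y" "h y"] rE h[OF y] by simp
    then show ?thesis
      using b1.fdist_eq_0[of "rot c h y" "h y"] rE h[OF y] by simp
  qed
  ultimately show ?thesis using ch by blast
qed

end

end

section \<open>The homogeneous lift\<close>


context bundle_lifting
begin

lemma norm_continuous_complex: "continuous_map X euclidean (\<lambda>y. complex_of_real (fnorm \<xi>2 y))"
  using continuous_map_compose[OF norm_cont, of euclidean complex_of_real]
  by (simp add: o_def continuous_on_of_real_id)

lemma homogeneous_lift:
  "\<exists>\<psi>. continuous_map X (bspace \<xi>1) \<psi> \<and>
    (\<forall>y\<in>E2. \<phi> (\<psi> y) = y \<and> (\<forall>c\<in>K. \<psi> (fscale \<xi>2 c y) = fscale \<xi>1 c (\<psi> y)))"
proof -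
  obtain f where f: "continuous_map X (bspace \<xi>1) f"
    "\<And>y. y \<in> E2 \<Longrightarrow> \<phi> (f y) = y" "\<And>y. y \<in> E2 \<Longrightarrow> fnorm \<xi>1 (f y) \<le> m * fnorm \<xi>2 y + (m + 5)"
    using continuous_lift by blast
  then have "clift f" by (simp add: clift_def)
  moreover obtain \<omega> where "dense_roots G \<omega>" using G_dense_roots by blast
  ultimately obtain h where h: "clift h" and bound: "\<And>y. y \<in> E2 \<Longrightarrow> fnorm \<xi>1 (h y) \<le> m * fnorm \<xi>2 y + (m + 5)"
    and inv: "\<And>y c. y \<in> E2 \<Longrightarrow> c \<in> G \<Longrightarrow> rot c h y = h y"
    using invariant_limit f(3) by metis
  have hE: "h y \<in> E1" "\<phi> (h y) = y" "p1 (h y) = p2 y" if "y \<in> E2" for y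
    using clift_E[OF h that] .
  have h_scale: "h (fscale \<xi>2 c y) = fscale \<xi>1 c (h y)" if y: "y \<in> E2" and c: "c \<in> G" for y c
  proof -
    have "fscale \<xi>2 c y \<in> E2" using y c by (simp add: b2.E_p)
    then have "h (fscale \<xi>2 c y) = fscale \<xi>1 c (rot c h y)"
      using c hE by (simp add: rot_def b1.scale_scale b1.scale_one)
    then show ?thesis using inv[OF y c] by simp
  qed
  let ?n = "fnorm \<xi>2"
  \<comment> \<open>Division by zero yields 0, so a vector of norm 0 is sent to the zero vector of
    its fiber and \<open>\<psi>\<close> vanishes there without a case distinction.\<close>
  define u where "u y = fscale \<xi>2 (of_real (1 / ?n y)) y" for y
  define \<psi> where "\<psi> y = fscale \<xi>1 (of_real (?n y)) (h (u y))" for y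
  have uE: "u y \<in> E2" "p2 (u y) = p2 y" if "y \<in> E2" for y
    using that b2.K_simps(1)[of "1 / ?n y"] by (simp_all add: u_def b2.E_p del: of_real_divide)
  have \<psi>E: "\<psi> y \<in> E1" "p1 (\<psi> y) = p2 y" if "y \<in> E2" for y
    using hE[OF uE(1)] uE that by (simp_all add: \<psi>_def b1.E_p)
  have \<psi>0: "\<psi> y = fzero \<xi>1 (p2 y)" if "y \<in> E2" "?n y = 0" for y
    using hE[OF uE(1)] uE that by (simp add: \<psi>_def b1.scale_0)
  have "\<phi> (\<psi> y) = y" if y: "y \<in> E2" for y
  proof (cases "?n y = 0")
    case True
    then show ?thesis using \<psi>0[OF y] b2.norm_eq_0[OF y] phi_zero base2[OF y] by simp
  next
    case False
    have "\<phi> (\<psi> y) = fscale \<xi>2 (of_real (?n y)) (u y)"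
      using hE[OF uE(1)[OF y]] by (simp add: \<psi>_def phi_scale)
    also have "\<dots> = fscale \<xi>2 (of_real (?n y) * of_real (1 / ?n y)) y"
      unfolding u_def by (rule b2.scale_scale) (use y in \<open>simp_all del: of_real_divide\<close>)
    also have "\<dots> = y" using False y by (simp add: b2.scale_one)
    finally show ?thesis .
  qed
  moreover have "\<psi> (fscale \<xi>2 c y) = fscale \<xi>1 c (\<psi> y)" if y: "y \<in> E2" and c: "c \<in> K" for y c
  proof (cases "c = 0 \<or> ?n y = 0")
    case True
    then have "?n (fscale \<xi>2 c y) = 0" using y c by (auto simp: b2.norm_scale)
    then have l: "\<psi> (fscale \<xi>2 c y) = fzero \<xi>1 (p2 y)"
      using \<psi>0[of "fscale \<xi>2 c y"] y c by (simp add: b2.E_p)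
    from True show ?thesis
    proof
      assume "c = 0"
      then show ?thesis using l \<psi>E[OF y] by (simp add: b1.scale_0)
    next
      assume "?n y = 0"
      then show ?thesis using l \<psi>0[OF y] c base2[OF y] by (simp add: b1.scale_zero)
    qed
  next
    case False
    \<comment> \<open>The phase of c. Normalisation cancels its modulus, so u(c y) = d u(y), and
      only the equivariance of h under unit scalars is called upon.\<close>
    define d where "d = c / of_real (cmod c)"
    have d: "d \<in> G" using c False K_cases by (auto simp: d_def G_def norm_divide simp del: G_simps)
    have "u (fscale \<xi>2 c y) = fscale \<xi>2 (of_real (1 / ?n (fscale \<xi>2 c y)) * c) y"
      unfolding u_def by (rule b2.scale_scale) (use y c in \<open>simp_all del: of_real_divide\<close>)
    also have "of_real (1 / ?n (fscale \<xi>2 c y)) * c = d * of_real (1 / ?n y)"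
      using y c by (simp add: d_def b2.norm_scale)
    also have "fscale \<xi>2 (d * of_real (1 / ?n y)) y = fscale \<xi>2 d (u y)"
      unfolding u_def by (rule b2.scale_scale[symmetric]) (use y d in \<open>simp_all del: of_real_divide\<close>)
    finally have "\<psi> (fscale \<xi>2 c y) = fscale \<xi>1 (of_real (cmod c * ?n y)) (fscale \<xi>1 d (h (u y)))"
      using h_scale[OF uE(1)[OF y] d] y c by (simp add: \<psi>_def b2.norm_scale)
    also have "\<dots> = fscale \<xi>1 (of_real (cmod c * ?n y) * d) (h (u y))"
      by (rule b1.scale_scale) (use d hE uE y in \<open>simp_all del: of_real_mult\<close>)
    also have "of_real (cmod c * ?n y) * d = c * of_real (?n y)"
      using False by (simp add: d_def)
    also have "fscale \<xi>1 (c * of_real (?n y)) (h (u y)) = fscale \<xi>1 c (\<psi> y)"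
      unfolding \<psi>_def by (rule b1.scale_scale[symmetric]) (use c hE uE y in simp_all)
    finally show ?thesis .
  qed
  moreover have "continuous_map X (bspace \<xi>1) \<psi>"
  proof (rule continuous_map_if_eventually[OF \<psi>E(1)])
    fix a S assume a: "a \<in> topspace X" and S: "b1.is_open S" "\<psi> a \<in> S"
    show "\<forall>\<^sub>F y in nhdsin X a. \<psi> y \<in> S"
    proof (cases "?n a = 0")
      case True
      obtain U e where U: "openin (base \<xi>1) U" "p2 a \<in> U" "e > 0"
        "\<forall>z\<in>E1. p1 z \<in> U \<longrightarrow> fnorm \<xi>1 z < e \<longrightarrow> z \<in> S"
        using b1.zero_nbhd[OF S(1) base2[OF a]] S(2) \<psi>0[OF a True] by auto
      \<comment> \<open>The bound m |u| + (m + 5) for h at a vector u of norm 1. It gives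
        |\<open>\<psi>\<close> y| \<le> M |y|, which forces continuity at zero vectors, where u need
        not be continuous.\<close>
      define M where "M = 2 * m + 5"
      have M: "M > 0" using m_pos by (simp add: M_def)
      have small: "fnorm \<xi>1 (\<psi> y) \<le> ?n y * M" if y: "y \<in> E2" for y
      proof (cases "?n y = 0")
        case True
        then show ?thesis using \<psi>0[OF y True] base2[OF y] by (simp add: b1.norm_zero)
      next
        case False
        then have "?n (u y) = 1"
          using y b2.K_simps(1)[of "1 / ?n y"] b2.norm_nonneg[OF y]
          by (simp add: u_def b2.norm_scale norm_divide del: b2.K_simps)
        then have "fnorm \<xi>1 (h (u y)) \<le> M"
          using bound[OF uE(1)[OF y]] by (simp add: M_def)
        then show ?thesis
          using hE[OF uE(1)[OF y]] b2.norm_nonneg[OF y] by (simp add: \<psi>_def b1.norm_scale mult_left_mono)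
      qed
      have "\<forall>\<^sub>F y in nhdsin X a. ?n y \<in> {..<e / M}"
        by (rule eventually_nhdsin_continuous[OF norm_cont _ a]) (use True U M in auto)
      with eventually_nhdsin_topspace eventually_nhdsin_continuous[OF p2_continuous U(1) a U(2)]
      show ?thesis
      proof eventually_elim
        case (elim y)
        have "?n y * M < e" using elim(3) M by (simp add: field_simps)
        then show ?case using U(4) \<psi>E[OF elim(1)] small[OF elim(1)] elim(2) by auto
      qed
    next
      case False
      then have pos: "?n a > 0" using b2.norm_nonneg[OF a] by simp
      \<comment> \<open>Truncating the norm from below makes the normalisation continuous on all of the bundle
        space, without changing it near \<open>a\<close>.\<close>
      define r where "r y = max (?n y) (?n a / 2)" for y
      have rpos: "r y > 0" for y using pos by (simp add: r_def)
      have "continuous_map X euclideanreal (\<lambda>y. 1 / r y)"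
        unfolding r_def using pos
        by (intro continuous_intros norm_cont) (auto simp: max_def)
      then have rc: "continuous_map X euclidean (\<lambda>y. complex_of_real (1 / r y))"
        using continuous_map_compose[of X euclideanreal "\<lambda>y. 1 / r y" euclidean complex_of_real]
        by (simp add: o_def continuous_on_of_real_id)
      define v where "v y = fscale \<xi>2 (of_real (1 / r y)) y" for y
      have "continuous_map X X v"
        unfolding v_def by (rule b2.continuous_scale[OF continuous_map_id[unfolded id_def] rc]) (rule b2.K_simps)
      then have "continuous_map X (bspace \<xi>1) (\<lambda>y. h (v y))"
        using h continuous_map_compose[of X X v "bspace \<xi>1" h] by (simp add: clift_def o_def)
      then have c: "continuous_map X (bspace \<xi>1) (\<lambda>y. fscale \<xi>1 (of_real (?n y)) (h (v y)))"
        by (rule b1.continuous_scale[OF _ norm_continuous_complex]) simp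
      have eq: "fscale \<xi>1 (of_real (?n y)) (h (v y)) = \<psi> y" if "?n a / 2 < ?n y" for y
        using that by (simp add: \<psi>_def u_def v_def r_def)
      have "\<forall>\<^sub>F y in nhdsin X a. ?n y \<in> {?n a / 2<..}"
        by (rule eventually_nhdsin_continuous[OF norm_cont _ a]) (use pos in auto)
      moreover have "\<forall>\<^sub>F y in nhdsin X a. fscale \<xi>1 (of_real (?n y)) (h (v y)) \<in> S"
        by (rule eventually_nhdsin_continuous[OF c S(1) a]) (use S(2) eq[of a] pos in simp)
      ultimately show ?thesis
        by eventually_elim (use eq in auto)
    qed
  qed
  ultimately show ?thesis by blast
qed

end

theorem proposition3p12:
  fixes K :: "complex set"
    and \<xi>1 :: "('e, 'b) bundle_data"
    and \<xi>2 :: "('f, 'b) bundle_data"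
    and \<phi> :: "'e \<Rightarrow> 'f"
    and m :: real
  assumes "K = \<real> \<or> K = UNIV"
    and "banach_bundle K \<xi>1"
    and "continuous_banach_bundle K \<xi>2"
    and "base \<xi>1 = base \<xi>2"
    and "banach_bundle_map K \<xi>1 \<xi>2 \<phi>"
    and "\<phi> ` topspace (bspace \<xi>1) = topspace (bspace \<xi>2)"
    and "paracompact_space (bspace \<xi>2)"
    and "m > 0"
    and "\<forall>y\<in>topspace (bspace \<xi>2). \<exists>x\<in>topspace (bspace \<xi>1). \<phi> x = y \<and> fnorm \<xi>1 x \<le> m * fnorm \<xi>2 y"
  shows "\<exists>\<psi>. continuous_map (bspace \<xi>2) (bspace \<xi>1) \<psi> \<and>
    (\<forall>y\<in>topspace (bspace \<xi>2). \<phi> (\<psi> y) = y \<and>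
       (\<forall>c\<in>K. \<psi> (fscale \<xi>2 c y) = fscale \<xi>1 c (\<psi> y)))"
proof -
  interpret c2: continuous_banach_bundle K \<xi>2 by fact
  interpret bundle_lifting K \<xi>1 \<xi>2 \<phi> m
    by (intro bundle_lifting.intro scalar_bundle.intro scalar_bundle_axioms.intro bundle_lifting_axioms.intro)
      (use assms c2.norm_continuous c2.banach_bundle_axioms in auto)
  show ?thesis by (rule homogeneous_lift)
qed

end
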